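(* Let $d\ge1$, $q\in(-d,2)\setminus\{0\}$, and $K_q(x)=-\frac1q|x|^q$ on $\mathbb R^d$. (i) If $0<q<2$ and $\mu\in\mathcal P(\mathbb R^d)$ is compactly supported, then there exists a sequence $\rho_n\in C_c^\infty(\mathbb R^d)$ of probability densities such that $$\frac{\mathcal D_q(\rho_n\mid\mu)}{\mathcal E_q(\rho_n-\mu)}\longrightarrow0.\tag{R}$$ Equivalently, $\mathcal D_q(\rho_n\mid\mu)/\mathrm{MMD}_q^2(\rho_n,\mu)\to0$. (ii) If $-d<q<0$, assume that $\mu\in\mathcal P(\mathbb R^d)$ and $$0<\iint|x-y|^q\,\mathrm d\mu(x)\,\mathrm d\mu(y)<\infty.$$ Assume moreover that there exist $R_0<\infty$ and a locally integrable Borel vector field $F_\mu:\mathbb R^d\setminus\overline B_{R_0}\to\mathbb R^d$ such that $K_q*\mu$ is finite on this exterior region, $$F_\mu=\nabla(K_q*\mu)\quad\text{in }\mathcal D'(\mathbb R^d\setminus\overline B_{R_0}),$$ and $$\lim_{|x|\to\infty}\bigl(|K_q*\mu(x)|+|F_\mu(x)|\bigr)=0.$$ Then there exists a sequence $\rho_n\in C_c^\infty(\mathbb R^d)$ of probability densities satisfying (R). Consequently, under either set of hypotheses there is no finite constant $C_{\mathrm{PL}}(\mu)$ such that $$\mathcal E_q(\rho-\mu)\le C_{\mathrm{PL}}(\mu)\,\mathcal D_q(\rho\mid\mu)$$ for all admissible probability densities $\rho$.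
   Context: $\mathcal P(\mathbb R^d)$: Borel probability measures; densities are identified with measures; $\overline B_{R_0}$ is the closed ball of radius $R_0$ centered at the origin. Whenever the expressions are finite, for a zero-mass signed measure $\sigma$, $$\mathcal E_q(\sigma):=\frac12\iint K_q(x-y)\,\mathrm d\sigma(x)\,\mathrm d\sigma(y),\qquad \mathcal D_q(\rho\mid\mu):=\int_{\mathbb R^d}|\nabla K_q*(\rho-\mu)|^2\,\mathrm d\rho.$$ Here $\nabla K_q(z)=-z|z|^{q-2}$ for $z\ne0$. For $0<q<2$, $\mathrm{MMD}_q^2(\rho,\mu)=-\frac12\iint|x-y|^q\,\mathrm d(\rho-\mu)(x)\,\mathrm d(\rho-\mu)(y)$ (for measures with finite $q$-th moment), so $\mathcal E_q(\rho-\mu)=q^{-1}\mathrm{MMD}_q^2(\rho,\mu)$. For $-d<q<0$ and $\rho\in C_c^1(\mathbb R^d)$, the source field $\nabla K_q*\rho$ is the ordinary convolution when $q>1-d$ and the Cauchy principal value $\lim_{\varepsilon\downarrow0}\int_{|z|>\varepsilon}\nabla K_q(z)\rho(x-z)\,\mathrm dz$ when $q\le1-d$. In part (ii), the target field $\nabla K_q*\mu$ on $\mathbb R^d\setminus\overline B_{R_0}$ is the representative $F_\mu$, so that for $\rho$ supported in $\mathbb R^d\setminus\overline B_{R_0}$ one has $\mathcal D_q(\rho\mid\mu)=\int|\nabla K_q*\rho-F_\mu|^2\,\mathrm d\rho$. "Admissible" densities are probability densities in $C_c^\infty(\mathbb R^d)$ for which $\mathcal E_q(\rho-\mu)$ and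 $\mathcal D_q(\rho\mid\mu)$ are defined and finite in this sense (in part (ii), supported in $\mathbb R^d\setminus\overline B_{R_0}$). *)

theory Defs
  imports "HOL-Analysis.Analysis" "HOL-Probability.Probability"
begin

text \<open>
  The space \<open>\<real>\<^sup>d\<close> is an arbitrary type of class \<^class>\<open>euclidean_space\<close>, with \<open>d = DIM('a) \<ge> 1\<close>.
\<close>

fun Ck_fun :: "nat \<Rightarrow> ('a::euclidean_space \<Rightarrow> real) \<Rightarrow> bool" where
  "Ck_fun 0 f \<longleftrightarrow> continuous_on UNIV f"
| "Ck_fun (Suc k) f \<longleftrightarrow>
     (\<forall>x. f differentiable (at x)) \<and>
     (\<forall>b\<in>Basis. Ck_fun k (\<lambda>x. frechet_derivative f (at x) b))"

definition smooth_fun :: "('a::euclidean_space \<Rightarrow> real) \<Rightarrow> bool" where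
  "smooth_fun f \<longleftrightarrow> (\<forall>k. Ck_fun k f)"

definition Cc_infty :: "'a::euclidean_space set \<Rightarrow> ('a \<Rightarrow> real) set" where
  "Cc_infty U = {f. smooth_fun f \<and> compact (closure (support_on UNIV f)) \<and>
                    closure (support_on UNIV f) \<subseteq> U}"

abbreviation density_measure :: "('a::euclidean_space \<Rightarrow> real) \<Rightarrow> 'a measure" where
  "density_measure \<rho> \<equiv> density lborel (\<lambda>x. ennreal (\<rho> x))"

definition smooth_prob_density :: "'a::euclidean_space set \<Rightarrow> ('a \<Rightarrow> real) \<Rightarrow> bool" where
  "smooth_prob_density U \<rho> \<longleftrightarrow>
     \<rho> \<in> Cc_infty U \<and> (\<forall>x. 0 \<le> \<rho> x) \<and> prob_space (density_measure \<rho>)"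

definition borel_prob :: "'a::euclidean_space measure \<Rightarrow> bool" where
  "borel_prob \<mu> \<longleftrightarrow> prob_space \<mu> \<and> sets \<mu> = sets borel"

definition measure_support :: "'a::euclidean_space measure \<Rightarrow> 'a set" where
  "measure_support \<mu> = {x. \<forall>U. open U \<longrightarrow> x \<in> U \<longrightarrow> 0 < emeasure \<mu> U}"

definition locally_integrable_in ::
  "'a::euclidean_space set \<Rightarrow> ('a \<Rightarrow> 'b::{banach, second_countable_topology}) \<Rightarrow> bool" where
  "locally_integrable_in U f \<longleftrightarrow> (\<forall>C. compact C \<longrightarrow> C \<subseteq> U \<longrightarrow> set_integrable lborel C f)"

text \<open>\<open>F = \<nabla>u\<close> in \<open>\<D>'(U)\<close>, where the functions \<open>u\<close> and \<open>F\<close> are regular distributions on \<open>U\<close>.\<close>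

definition distributional_gradient_in ::
  "'a::euclidean_space set \<Rightarrow> ('a \<Rightarrow> real) \<Rightarrow> ('a \<Rightarrow> 'a) \<Rightarrow> bool" where
  "distributional_gradient_in U u F \<longleftrightarrow>
     locally_integrable_in U u \<and> locally_integrable_in U F \<and>
     (\<forall>\<phi> \<in> Cc_infty U. \<forall>b\<in>Basis.
        (LINT x:U|lborel. u x * frechet_derivative \<phi> (at x) b) =
        - (LINT x:U|lborel. (F x \<bullet> b) * \<phi> x))"

text \<open>
  \<open>dist_pow q x y\<close> is \<open>\<bar>x - y\<bar>\<^sup>q\<close> with the value \<open>\<infinity>\<close> on the diagonal when \<open>q < 0\<close>; it is used for
  every finiteness condition.  The real-valued \<open>riesz_kernel\<close> has the junk value \<open>0\<close> at the origin for
  \<open>q < 0\<close>; this is harmless in integrals whose \<open>dist_pow\<close> counterpart is finite, since then the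
  diagonal is a null set.
\<close>

definition dist_pow :: "real \<Rightarrow> 'a::euclidean_space \<Rightarrow> 'a \<Rightarrow> ennreal" where
  "dist_pow q x y = (if q < 0 \<and> x = y then \<infinity> else ennreal (dist x y powr q))"

definition riesz_kernel :: "real \<Rightarrow> 'a::euclidean_space \<Rightarrow> real" where
  "riesz_kernel q x = - (1 / q) * norm x powr q"

definition grad_riesz_kernel :: "real \<Rightarrow> 'a::euclidean_space \<Rightarrow> 'a" where
  "grad_riesz_kernel q z = - (norm z powr (q - 2)) *\<^sub>R z"

definition pow_integral :: "real \<Rightarrow> 'a::euclidean_space measure \<Rightarrow> 'a measure \<Rightarrow> ennreal" where
  "pow_integral q \<alpha> \<beta> = (\<integral>\<^sup>+x. \<integral>\<^sup>+y. dist_pow q x y \<partial>\<beta> \<partial>\<alpha>)"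

definition potential :: "real \<Rightarrow> 'a::euclidean_space measure \<Rightarrow> 'a \<Rightarrow> real" where
  "potential q \<mu> x = (LINT y|\<mu>. riesz_kernel q (x - y))"

definition potential_finite :: "real \<Rightarrow> 'a::euclidean_space measure \<Rightarrow> 'a \<Rightarrow> bool" where
  "potential_finite q \<mu> x \<longleftrightarrow> (\<integral>\<^sup>+y. dist_pow q x y \<partial>\<mu>) < \<infinity>"

text \<open>
  \<open>\<integral>\<integral> k(x - y) d\<sigma>(x) d\<sigma>(y)\<close> for the signed measure \<open>\<sigma> = \<rho> - \<mu>\<close>, expanded bilinearly.
\<close>

definition difference_form ::
  "('a::euclidean_space \<Rightarrow> real) \<Rightarrow> 'a measure \<Rightarrow> 'a measure \<Rightarrow> real" where
  "difference_form k \<rho> \<mu> =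
       (LINT x|\<rho>. LINT y|\<rho>. k (x - y)) - (LINT x|\<rho>. LINT y|\<mu>. k (x - y))
     - (LINT x|\<mu>. LINT y|\<rho>. k (x - y)) + (LINT x|\<mu>. LINT y|\<mu>. k (x - y))"

text \<open>\<open>\<E>\<^sub>q(\<rho> - \<mu>)\<close>.\<close>

definition riesz_energy :: "real \<Rightarrow> 'a::euclidean_space measure \<Rightarrow> 'a measure \<Rightarrow> real" where
  "riesz_energy q \<rho> \<mu> = (1/2) * difference_form (riesz_kernel q) \<rho> \<mu>"

definition riesz_energy_finite :: "real \<Rightarrow> 'a::euclidean_space measure \<Rightarrow> 'a measure \<Rightarrow> bool" where
  "riesz_energy_finite q \<rho> \<mu> \<longleftrightarrow>
     pow_integral q \<rho> \<rho> < \<infinity> \<and> pow_integral q \<rho> \<mu> < \<infinity> \<and>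
     pow_integral q \<mu> \<rho> < \<infinity> \<and> pow_integral q \<mu> \<mu> < \<infinity>"

definition MMD_squared :: "real \<Rightarrow> 'a::euclidean_space measure \<Rightarrow> 'a measure \<Rightarrow> real" where
  "MMD_squared q \<rho> \<mu> = - (1/2) * difference_form (\<lambda>z. norm z powr q) \<rho> \<mu>"

definition pv_truncation ::
  "real \<Rightarrow> ('a::euclidean_space \<Rightarrow> real) \<Rightarrow> 'a \<Rightarrow> real \<Rightarrow> 'a" where
  "pv_truncation q \<rho> x \<epsilon> = (LINT z:{z. \<epsilon> < norm z}|lborel. \<rho> (x - z) *\<^sub>R grad_riesz_kernel q z)"

text \<open>
  \<open>\<nabla>K\<^sub>q * \<rho>\<close>: ordinary convolution if \<open>q > 1 - d\<close>, Cauchy principal value otherwise.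
\<close>

definition source_field :: "real \<Rightarrow> ('a::euclidean_space \<Rightarrow> real) \<Rightarrow> 'a \<Rightarrow> 'a" where
  "source_field q \<rho> x =
     (if 1 - real DIM('a) < q
      then (LINT y|lborel. \<rho> y *\<^sub>R grad_riesz_kernel q (x - y))
      else Lim (at_right 0) (pv_truncation q \<rho> x))"

definition source_field_defined ::
  "real \<Rightarrow> ('a::euclidean_space \<Rightarrow> real) \<Rightarrow> 'a \<Rightarrow> bool" where
  "source_field_defined q \<rho> x \<longleftrightarrow>
     (if 1 - real DIM('a) < q
      then integrable lborel (\<lambda>y. \<rho> y *\<^sub>R grad_riesz_kernel q (x - y))
      else (\<exists>l. (pv_truncation q \<rho> x \<longlongrightarrow> l) (at_right 0)))"

text \<open>
  The target field \<open>\<nabla>K\<^sub>q * \<mu>\<close> as an ordinary convolution (used for \<open>0 < q < 2\<close>).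
\<close>

definition target_field :: "real \<Rightarrow> 'a::euclidean_space measure \<Rightarrow> 'a \<Rightarrow> 'a" where
  "target_field q \<mu> x = (LINT y|\<mu>. grad_riesz_kernel q (x - y))"

text \<open>
  \<open>\<D>\<^sub>q(\<rho> | \<mu>)\<close> for \<open>\<rho>\<close> supported in \<open>U\<close>, where \<open>G\<close> represents \<open>\<nabla>K\<^sub>q * \<mu>\<close> on \<open>U\<close>;
  the values of \<open>G\<close> outside \<open>U\<close> do not matter.
\<close>

definition dissipation ::
  "real \<Rightarrow> 'a::euclidean_space set \<Rightarrow> ('a \<Rightarrow> 'a) \<Rightarrow> ('a \<Rightarrow> real) \<Rightarrow> real" where
  "dissipation q U G \<rho> = (LINT x:U|density_measure \<rho>. (norm (source_field q \<rho> x - G x))\<^sup>2)"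

definition dissipation_finite ::
  "real \<Rightarrow> 'a::euclidean_space set \<Rightarrow> ('a \<Rightarrow> 'a) \<Rightarrow> ('a \<Rightarrow> real) \<Rightarrow> bool" where
  "dissipation_finite q U G \<rho> \<longleftrightarrow>
     (AE x in density_measure \<rho>. source_field_defined q \<rho> x) \<and>
     set_integrable (density_measure \<rho>) U (\<lambda>x. (norm (source_field q \<rho> x - G x))\<^sup>2)"

definition admissible_global ::
  "real \<Rightarrow> 'a::euclidean_space measure \<Rightarrow> ('a \<Rightarrow> real) \<Rightarrow> bool" where
  "admissible_global q \<mu> \<rho> \<longleftrightarrow>
     smooth_prob_density UNIV \<rho> \<and>
     riesz_energy_finite q (density_measure \<rho>) \<mu> \<and>
     (AE x in density_measure \<rho>. integrable \<mu> (\<lambda>y. grad_riesz_kernel q (x - y))) \<and>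
     dissipation_finite q UNIV (target_field q \<mu>) \<rho>"

definition admissible_exterior ::
  "real \<Rightarrow> 'a::euclidean_space measure \<Rightarrow> real \<Rightarrow> ('a \<Rightarrow> 'a) \<Rightarrow> ('a \<Rightarrow> real) \<Rightarrow> bool" where
  "admissible_exterior q \<mu> R0 F \<rho> \<longleftrightarrow>
     smooth_prob_density (- cball 0 R0) \<rho> \<and>
     riesz_energy_finite q (density_measure \<rho>) \<mu> \<and>
     dissipation_finite q (- cball 0 R0) F \<rho>"

end

theory Submission
  imports Defs
begin

text \<open>
  The counterexamples are smooth bumps that travel to infinity and flatten out at the same time.  Let
  \<open>\<rho>\<close> be a normalised bump supported in the ball of radius \<open>r\<close> around \<open>4 r e\<close>, with \<open>e\<close> a unit vector.
  Its support lies between the distances \<open>3 r\<close> and \<open>5 r\<close> from the origin, and its height and its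
  Lipschitz constant are \<open>O(1 / r ^ d)\<close> (\<open>spread_density_exists\<close>).  As \<open>r\<close> grows, the field
  \<open>\<nabla>K * (\<rho> - \<mu>)\<close> on the support of \<open>\<rho>\<close> becomes small compared with the square root of the energy.

  For \<open>0 < q < 2\<close> the energy grows like \<open>r powr q\<close>.  It is \<open>1 / (2 q)\<close> times twice the \<open>\<rho>\<close>-\<open>\<mu>\<close>
  integral of \<open>\<bar>x - y\<bar> powr q\<close>, less the two self-integrals.  A point of the support of \<open>\<rho>\<close> is at
  distance at least \<open>2 r\<close> from the support of \<open>\<mu>\<close>, while two points in the support of \<open>\<rho>\<close> are at
  distance at most \<open>2 r\<close>; so one of the two cross terms pays for the self-interaction of \<open>\<rho>\<close>, and the
  other one exceeds the fixed self-interaction of \<open>\<mu>\<close> by more and more.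
  Both fields are \<open>O(r powr max 0 (q - 1))\<close> on the support of \<open>\<rho>\<close>, and \<open>2 * max 0 (q - 1) < q\<close>, which
  is where \<open>q < 2\<close> enters (\<open>small_ratio_positive_exponent\<close>).

  For \<open>- d < q < 0\<close> the kernel is singular at the origin and decays at infinity.  The potential of a
  density of height \<open>O(1 / r ^ d)\<close> tends to \<open>0\<close> uniformly on the whole space
  (\<open>potential_le_spread_bound\<close>, \<open>spread_bound_tendsto_0\<close>): up to the distance \<open>sqrt r\<close> the small height
  wins, because \<open>\<bar>z\<bar> powr q\<close> is locally integrable, and beyond it the decay of the kernel wins.  Hence the
  self-energy of \<open>\<rho>\<close> and the mixed energy vanish in the limit, and the energy of \<open>\<rho> - \<mu>\<close> tends to that of
  \<open>\<mu>\<close>, which is positive.  The field of \<open>\<mu>\<close> vanishes at infinity by assumption.  The field of \<open>\<rho>\<close>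
  vanishes uniformly by the same splitting; when it is only a principal value, oddness of the kernel
  allows \<open>\<rho> x\<close> to be subtracted on the unit ball, and the Lipschitz bound lowers the singularity from
  \<open>\<bar>z\<bar> powr (q - 1)\<close> to the integrable \<open>\<bar>z\<bar> powr q\<close> (\<open>source_field_spread\<close>).
\<close>

section \<open>Smooth bumps\<close>

lemma Ck_fun_Suc_imp: "Ck_fun (Suc k) f \<Longrightarrow> Ck_fun k f"
proof (induction k arbitrary: f)
  case 0
  then show ?case
    by (auto intro!: differentiable_imp_continuous_on simp: differentiable_on_def
        intro: differentiable_at_withinI)
next
  case (Suc k)
  then show ?case by (metis Ck_fun.simps(2))
qed

text \<open>
  Smoothness is stated through iterated directional derivatives, so it is established by exhibiting
  the derivative of \<open>f\<close> in each direction \<open>b\<close> as a function \<open>G b\<close> that is again of class \<open>C^k\<close>.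
\<close>

lemma Ck_fun_SucI:
  assumes "\<And>x. (f has_derivative (\<lambda>b. G b x)) (at x)"
    and "\<And>b. b \<in> Basis \<Longrightarrow> Ck_fun k (G b)"
  shows "Ck_fun (Suc k) f"
proof -
  have "frechet_derivative f (at x) = (\<lambda>b. G b x)" for x
    using frechet_derivative_at[OF assms(1)] by simp
  then show ?thesis
    using assms by (auto simp: differentiable_def)
qed

lemma Ck_fun_SucD:
  assumes "Ck_fun (Suc k) f"
  shows "(f has_derivative frechet_derivative f (at x)) (at x)"
  using assms by (simp add: frechet_derivative_works)

lemma Ck_fun_const: "Ck_fun k (\<lambda>_::'a::euclidean_space. c)"
proof (induction k arbitrary: c)
  case (Suc k)
  show ?case
    by (rule Ck_fun_SucI[where G = "\<lambda>_ _. 0"]) (auto intro!: derivative_eq_intros Suc)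
qed simp

lemma Ck_fun_affine: "Ck_fun k (\<lambda>x::'a::euclidean_space. \<alpha> + x \<bullet> v)"
proof (cases k)
  case (Suc m)
  show ?thesis unfolding Suc
    by (rule Ck_fun_SucI[where G = "\<lambda>b _. b \<bullet> v"])
      (auto intro!: derivative_eq_intros Ck_fun_const)
qed (auto intro!: continuous_intros)

lemma Ck_fun_add: "Ck_fun k f \<Longrightarrow> Ck_fun k g \<Longrightarrow> Ck_fun k (\<lambda>x. f x + g x)"
proof (induction k arbitrary: f g)
  case (Suc k)
  show ?case
    by (rule Ck_fun_SucI[where G = "\<lambda>b x. frechet_derivative f (at x) b + frechet_derivative g (at x) b"])
      (use Suc in \<open>auto intro!: derivative_intros Ck_fun_SucD[of k]\<close>)
qed (auto intro: continuous_intros)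

lemma Ck_fun_mult: "Ck_fun k f \<Longrightarrow> Ck_fun k g \<Longrightarrow> Ck_fun k (\<lambda>x. f x * g x)"
proof (induction k arbitrary: f g)
  case (Suc k)
  show ?case
  proof (rule Ck_fun_SucI[where
        G = "\<lambda>b x. f x * frechet_derivative g (at x) b + frechet_derivative f (at x) b * g x"])
    show "((\<lambda>x. f x * g x) has_derivative
            (\<lambda>b. f x * frechet_derivative g (at x) b + frechet_derivative f (at x) b * g x)) (at x)" for x
      using Suc.prems by (intro has_derivative_mult Ck_fun_SucD[of k])
    show "Ck_fun k (\<lambda>x. f x * frechet_derivative g (at x) b + frechet_derivative f (at x) b * g x)"
      if "b \<in> Basis" for b
      using Suc.prems that Ck_fun_Suc_imp[OF Suc.prems(1)] Ck_fun_Suc_imp[OF Suc.prems(2)]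
      by (intro Ck_fun_add Suc.IH) (auto simp only: Ck_fun.simps(2))
  qed
qed (auto intro: continuous_intros)

text \<open>
  The functions \<open>p (1 / t) * exp (- 1 / t)\<close>, continued by \<open>0\<close> to \<open>t \<le> 0\<close>.  Allowing a polynomial
  factor makes the family closed under differentiation, so that smoothness of its composition with a
  quadratic form follows by one induction.
\<close>

definition flat_exp :: "real poly \<Rightarrow> real \<Rightarrow> real" where
  "flat_exp p t = (if 0 < t then poly p (1 / t) * exp (- (1 / t)) else 0)"

lemma poly_times_exp_minus_tendsto_0:
  "((\<lambda>s. poly p s * exp (- s)) \<longlongrightarrow> (0::real)) at_top"
proof -
  have "((\<lambda>s. \<Sum>i\<le>degree p. coeff p i * (s ^ i / exp s)) \<longlongrightarrow> (\<Sum>i\<le>degree p. coeff p i * 0)) at_top"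
    by (intro tendsto_intros tendsto_power_div_exp_0)
  then show ?thesis
    by (simp add: poly_altdef exp_minus sum_distrib_right divide_inverse mult.assoc)
qed

text \<open>
  With \<open>u = 1 / t\<close> one has \<open>du / dt = - u^2\<close>, so the derivative of \<open>p u * exp (- u)\<close> is
  \<open>u^2 * (p u - p' u) * exp (- u)\<close>.  At \<open>t = 0\<close> the difference quotient \<open>u * p u * exp (- u)\<close> tends to
  \<open>0\<close> because the exponential beats every polynomial.
\<close>

lemma flat_exp_has_derivative:
  "(flat_exp p has_real_derivative flat_exp ([:0, 0, 1:] * (p - pderiv p)) t) (at t)"
proof -
  consider "t < 0" | "t = 0" | "0 < t" by linarith
  then show ?thesis
  proof cases
    case 1
    have "((\<lambda>_. 0) has_real_derivative 0) (at t)" by simp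
    moreover have "\<forall>\<^sub>F s in nhds t. s < 0"
      using 1 by (rule eventually_nhds_in_open[OF open_lessThan, of t 0, simplified])
    ultimately show ?thesis
      using 1 by (subst DERIV_cong_ev[OF refl _ refl, where g = "\<lambda>_. 0"])
        (auto simp: flat_exp_def elim: eventually_mono)
  next
    case 2
    have "((\<lambda>h. poly (pCons 0 p) (inverse h) * exp (- inverse h)) \<longlongrightarrow> 0) (at_right 0)"
      by (rule filterlim_compose[OF poly_times_exp_minus_tendsto_0 filterlim_inverse_at_top_right])
    then have r: "((\<lambda>h. flat_exp p h / h) \<longlongrightarrow> 0) (at_right 0)"
      by (rule Lim_transform_eventually)
        (auto simp: flat_exp_def eventually_at_filter divide_simps)
    have l: "((\<lambda>h. flat_exp p h / h) \<longlongrightarrow> 0) (at_left 0)"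
      by (rule Lim_transform_eventually[OF tendsto_const])
        (auto simp: flat_exp_def eventually_at_filter)
    have "((\<lambda>h. flat_exp p h / h) \<longlongrightarrow> 0) (at 0)"
      using r l filterlim_split_at by blast
    then show ?thesis using 2 by (simp add: DERIV_def flat_exp_def)
  next
    case 3
    have "((\<lambda>t. poly p (1 / t) * exp (- (1 / t))) has_real_derivative
            poly ([:0, 0, 1:] * (p - pderiv p)) (1 / t) * exp (- (1 / t))) (at t)"
      using 3 by (auto intro!: derivative_eq_intros poly_DERIV[THEN DERIV_chain2]
          simp: field_simps power2_eq_square)
    moreover have "\<forall>\<^sub>F s in nhds t. 0 < s"
      using 3 by (rule eventually_nhds_in_open[OF open_greaterThan, of t 0, simplified])
    ultimately show ?thesis
      using 3 by (subst DERIV_cong_ev[OF refl _ refl, where g = "\<lambda>t. poly p (1 / t) * exp (- (1 / t))"])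
        (auto simp: flat_exp_def elim: eventually_mono)
  qed
qed

text \<open>
  The classical bump \<open>exp (- 1 / (1 - \<bar>(x - c) / r\<bar>^2))\<close>, which vanishes outside the open ball of radius \<open>r\<close>.
\<close>

definition ball_bump :: "'a::euclidean_space \<Rightarrow> real \<Rightarrow> 'a \<Rightarrow> real" where
  "ball_bump c r x = flat_exp 1 (1 - (norm ((1 / r) *\<^sub>R (x - c)))\<^sup>2)"

lemma Ck_fun_flat_exp_ball:
  "Ck_fun k (\<lambda>x::'a::euclidean_space. flat_exp p (1 - (norm (s *\<^sub>R (x - c)))\<^sup>2))"
proof (induction k arbitrary: p)
  case 0
  have "continuous_on UNIV (flat_exp p)"
    using DERIV_continuous_on[OF flat_exp_has_derivative] by blast
  then show ?case
    by (auto intro!: continuous_intros continuous_on_compose2[of UNIV "flat_exp p"])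
next
  case (Suc k)
  define p' where "p' = [:0, 0, 1:] * (p - pderiv p)"
  let ?Q = "\<lambda>x::'a. 1 - (norm (s *\<^sub>R (x - c)))\<^sup>2"
  show ?case
  proof (rule Ck_fun_SucI[where
        G = "\<lambda>b x. flat_exp p' (?Q x) * (2 * s\<^sup>2 * (c \<bullet> b) + x \<bullet> (- (2 * s\<^sup>2) *\<^sub>R b))"])
    fix x :: 'a
    have Q: "(?Q has_derivative (\<lambda>b. 2 * s\<^sup>2 * (c \<bullet> b) + x \<bullet> (- (2 * s\<^sup>2) *\<^sub>R b))) (at x)"
      unfolding power2_norm_eq_inner
      by (auto intro!: derivative_eq_intros simp: algebra_simps inner_commute power2_eq_square)
    have "((\<lambda>x. flat_exp p (?Q x)) has_derivative
        (\<lambda>b. (2 * s\<^sup>2 * (c \<bullet> b) + x \<bullet> (- (2 * s\<^sup>2) *\<^sub>R b)) * flat_exp p' (?Q x))) (at x)"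
      unfolding p'_def by (rule DERIV_compose_FDERIV[OF flat_exp_has_derivative Q])
    then show "((\<lambda>x. flat_exp p (?Q x)) has_derivative
        (\<lambda>b. flat_exp p' (?Q x) * (2 * s\<^sup>2 * (c \<bullet> b) + x \<bullet> (- (2 * s\<^sup>2) *\<^sub>R b)))) (at x)"
      by (simp add: mult.commute)
  qed (intro Ck_fun_mult Suc.IH Ck_fun_affine)
qed

lemma smooth_fun_scaled_bump: "smooth_fun (\<lambda>x. a * ball_bump c r x)"
  unfolding smooth_fun_def ball_bump_def by (intro allI Ck_fun_mult Ck_fun_const Ck_fun_flat_exp_ball)

text \<open>
  The derivative is \<open>u^2 * exp (- u)\<close> with \<open>u = 1 / t\<close>, which is at most \<open>4\<close> since
  \<open>u / 2 \<le> exp (u / 2)\<close>.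
\<close>

lemma flat_exp_1_lipschitz: "\<bar>flat_exp 1 s - flat_exp 1 t\<bar> \<le> 4 * \<bar>s - t\<bar>"
proof -
  have b: "norm (flat_exp ([:0, 0, 1:] * (1 - pderiv 1)) t) \<le> 4" for t
  proof (cases "0 < t")
    case True
    define u where "u = 1 / t"
    have u: "0 < u" using True by (simp add: u_def)
    have "u\<^sup>2 \<le> 4 * (1 + u / 2)\<^sup>2" using u by (simp add: power2_eq_square algebra_simps)
    also have "\<dots> \<le> 4 * (exp (u / 2))\<^sup>2"
      using u exp_ge_add_one_self[of "u / 2"] by (intro mult_left_mono power_mono) auto
    also have "\<dots> = 4 * exp u" by (simp add: power2_eq_square flip: exp_add)
    finally have "u\<^sup>2 * exp (- u) \<le> 4 * exp u * exp (- u)" by (intro mult_right_mono) auto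
    moreover have "exp u * exp (- u) = 1" by (simp flip: exp_add)
    ultimately have "u\<^sup>2 * exp (- u) \<le> 4" by (simp only: mult.assoc)
    then show ?thesis using True by (simp add: flat_exp_def u_def power2_eq_square)
  qed (simp add: flat_exp_def)
  show ?thesis
    using field_differentiable_bound[OF convex_UNIV _ b, where f = "flat_exp 1" and x = s and y = t,
        OF flat_exp_has_derivative] by (simp add: abs_minus_commute)
qed

text \<open>
  The bump only depends on the distance to the centre in units of \<open>r\<close>, cut off at \<open>1\<close>.  This
  cut-off distance is \<open>1\<close>-Lipschitz because \<open>r \<ge> 1\<close>, squaring is \<open>2\<close>-Lipschitz on \<open>[0, 1]\<close>, and the
  profile is \<open>4\<close>-Lipschitz.
\<close>

lemma ball_bump_lipschitz:
  assumes "1 \<le> r"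
  shows "\<bar>ball_bump c r x - ball_bump c r y\<bar> \<le> 8 * dist x y"
proof -
  let ?m = "\<lambda>x. min 1 (norm ((1 / r) *\<^sub>R (x - c)))"
  have eq: "ball_bump c r x = flat_exp 1 (1 - (?m x)\<^sup>2)" for x
  proof (cases "norm ((1 / r) *\<^sub>R (x - c)) \<le> 1")
    case False
    then have "1 \<le> (norm ((1 / r) *\<^sub>R (x - c)))\<^sup>2" by (intro one_le_power) linarith
    then have "\<not> (norm ((1 / r) *\<^sub>R (x - c)))\<^sup>2 < 1" by linarith
    then show ?thesis using False by (simp add: ball_bump_def min_def flat_exp_def del: norm_scaleR)
  qed (simp add: ball_bump_def min_def)
  have d: "norm ((1 / r) *\<^sub>R (x - c) - (1 / r) *\<^sub>R (y - c)) \<le> dist x y"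
  proof -
    have "(1 / r) *\<^sub>R (x - c) - (1 / r) *\<^sub>R (y - c) = (1 / r) *\<^sub>R (x - y)"
      by (simp add: algebra_simps)
    then show ?thesis using assms
      by (simp add: dist_norm divide_le_eq mult_left_le mult_le_cancel_left1)
  qed
  have "\<bar>?m x - ?m y\<bar> \<le> \<bar>norm ((1 / r) *\<^sub>R (x - c)) - norm ((1 / r) *\<^sub>R (y - c))\<bar>" by linarith
  also have "\<dots> \<le> dist x y" using norm_triangle_ineq3 d order_trans by blast
  finally have m: "\<bar>?m x - ?m y\<bar> \<le> dist x y" .
  have "\<bar>ball_bump c r x - ball_bump c r y\<bar> \<le> 4 * \<bar>(1 - (?m x)\<^sup>2) - (1 - (?m y)\<^sup>2)\<bar>"
    unfolding eq by (rule flat_exp_1_lipschitz)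
  also have "\<bar>(1 - (?m x)\<^sup>2) - (1 - (?m y)\<^sup>2)\<bar> = \<bar>?m x - ?m y\<bar> * \<bar>?m x + ?m y\<bar>"
  proof -
    have "(1 - a\<^sup>2) - (1 - b\<^sup>2) = - ((a - b) * (a + b))" for a b :: real
      by (simp add: power2_eq_square algebra_simps)
    then show ?thesis by (simp only: abs_minus_cancel abs_mult)
  qed
  also have "\<dots> \<le> dist x y * 2"
  proof (rule mult_mono[OF m])
    have "0 \<le> ?m x" "?m x \<le> 1" "0 \<le> ?m y" "?m y \<le> 1" by auto
    then show "\<bar>?m x + ?m y\<bar> \<le> 2" by linarith
  qed auto
  finally show ?thesis by simp
qed

text \<open>
  The same rate \<open>B / r ^ d\<close> for the height and for the Lipschitz constant lets one number control the
  density in all later estimates.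
\<close>

definition spread_density :: "real \<Rightarrow> 'a::euclidean_space \<Rightarrow> real \<Rightarrow> ('a \<Rightarrow> real) \<Rightarrow> bool" where
  "spread_density B c r \<rho> \<longleftrightarrow> smooth_fun \<rho> \<and> (\<forall>x. 0 \<le> \<rho> x) \<and> (\<forall>x. \<rho> x \<noteq> 0 \<longrightarrow> x \<in> ball c r) \<and>
     (\<forall>x. \<rho> x \<le> B / r ^ DIM('a)) \<and> (\<forall>x y. \<bar>\<rho> x - \<rho> y\<bar> \<le> B / r ^ DIM('a) * dist x y) \<and>
     (\<integral>\<^sup>+x. \<rho> x \<partial>lborel) = 1"

text \<open>
  The bump has height at most \<open>1\<close>, Lipschitz constant at most \<open>8\<close>, and is bounded below on the ball of
  half the radius, so its mass is at least a constant times \<open>r ^ d\<close>.  The true Lipschitz constant of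
  the normalised bump is smaller by a further factor \<open>r\<close>, but the height and the Lipschitz constant
  always enter together, and the height dominates.
\<close>

lemma spread_density_exists:
  obtains B where "0 < B"
    and "\<And>r (c::'a::euclidean_space). 1 \<le> r \<Longrightarrow> \<exists>\<rho>. spread_density B c r \<rho>"
proof -
  define m where "m = flat_exp 1 (3 / 4)"
  define v where "v = unit_ball_vol (real DIM('a)) / 2 ^ DIM('a)"
  have m: "0 < m" by (simp add: m_def flat_exp_def)
  have v: "0 < v" by (simp add: v_def)
  define B where "B = 8 / (m * v)"
  have B: "0 < B" using m v by (simp add: B_def)
  have "\<exists>\<rho>. spread_density B c r \<rho>" if r: "1 \<le> r" for r :: real and c :: 'a
  proof -
    let ?b = "ball_bump c r"
    have smb: "smooth_fun ?b" using smooth_fun_scaled_bump[of 1 c r] by simp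
    have "Ck_fun 0 ?b" using smb unfolding smooth_fun_def by blast
    then have cont: "continuous_on UNIV ?b" by simp
    have meas[measurable]: "?b \<in> borel_measurable borel"
      using cont by (rule borel_measurable_continuous_onI)
    have b0: "0 \<le> ?b x" "?b x \<le> 1" for x by (auto simp: ball_bump_def flat_exp_def)
    have sup: "x \<in> ball c r" if "?b x \<noteq> 0" for x
    proof -
      have "(norm ((1 / r) *\<^sub>R (x - c)))\<^sup>2 < 1" using that by (auto simp: ball_bump_def flat_exp_def split: if_splits)
      then have "norm ((1 / r) *\<^sub>R (x - c)) < 1" by (simp add: power_less_one_iff abs_square_less_1)
      then show ?thesis using r by (simp add: dist_norm norm_minus_commute divide_less_eq)
    qed
    have low: "m \<le> ?b x" if "x \<in> ball c (r / 2)" for x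
    proof -
      have "norm ((1 / r) *\<^sub>R (x - c)) \<le> 1 / 2"
        using that r by (simp add: dist_norm norm_minus_commute divide_le_eq)
      then have "(norm ((1 / r) *\<^sub>R (x - c)))\<^sup>2 \<le> (1 / 2)\<^sup>2" by (intro power_mono) auto
      then have "3 / 4 \<le> 1 - (norm ((1 / r) *\<^sub>R (x - c)))\<^sup>2" by (simp add: power2_eq_square)
      then show ?thesis
        unfolding m_def ball_bump_def flat_exp_def by (auto simp: field_simps)
    qed
    define Z where "Z = (\<integral>\<^sup>+x. ?b x \<partial>lborel)"
    have "Z \<le> (\<integral>\<^sup>+x. indicator (ball c r) x \<partial>lborel)"
      unfolding Z_def by (intro nn_integral_mono) (use b0 sup in \<open>auto simp: indicator_def\<close>)
    also have "\<dots> = emeasure lborel (ball c r)" by simp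
    finally have Zfin: "Z < \<infinity>" using emeasure_lborel_ball_finite[of c r] by (auto simp: top.not_eq_extremum)
    have vol: "emeasure lborel (ball c (r / 2)) = ennreal (v * r ^ DIM('a))"
      using r by (simp add: emeasure_ball v_def power_divide)
    have "ennreal (m * (v * r ^ DIM('a))) = ennreal m * emeasure lborel (ball c (r / 2))"
      unfolding vol using m v r by (simp add: ennreal_mult)
    also have "\<dots> = (\<integral>\<^sup>+x. ennreal m * indicator (ball c (r / 2)) x \<partial>lborel)"
      by (simp add: nn_integral_cmult_indicator)
    also have "\<dots> \<le> Z"
      unfolding Z_def by (intro nn_integral_mono) (use low in \<open>auto simp: indicator_def ennreal_leI\<close>)
    finally have Zlow: "ennreal (m * v * r ^ DIM('a)) \<le> Z" by (simp add: mult.assoc)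
    define z where "z = enn2real Z"
    have Zz: "Z = ennreal z" using Zfin by (simp add: z_def)
    have zlow: "m * v * r ^ DIM('a) \<le> z"
    proof -
      have "0 \<le> z" by (simp add: z_def)
      then show ?thesis using Zlow unfolding Zz by (simp only: ennreal_le_iff)
    qed
    have "0 < m * v * r ^ DIM('a)" using m v r by simp
    then have z0: "0 < z" using zlow by simp
    have iz: "8 * (1 / z) \<le> B / r ^ DIM('a)"
    proof -
      have "1 / z \<le> 1 / (m * v * r ^ DIM('a))"
        using zlow \<open>0 < m * v * r ^ DIM('a)\<close> by (intro divide_left_mono) (use z0 in auto)
      then show ?thesis by (simp add: B_def)
    qed
    let ?\<rho> = "\<lambda>x. 1 / z * ?b x"
    \<comment> \<open>The factor \<open>8\<close> is only required by the Lipschitz constant, which shares its bound with the height.\<close>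
    have le1: "?\<rho> x \<le> 8 * (1 / z)" for x
      using b0[of x] z0 by (auto simp: divide_simps)
    have "(\<integral>\<^sup>+x. ?\<rho> x \<partial>lborel) = (\<integral>\<^sup>+x. ennreal (1 / z) * ?b x \<partial>lborel)"
      using z0 b0 by (intro nn_integral_cong) (simp only: ennreal_mult[symmetric] zero_le_divide_1_iff less_imp_le)
    also have "\<dots> = ennreal (1 / z) * Z" unfolding Z_def by (intro nn_integral_cmult) simp
    also have "\<dots> = 1" using z0 unfolding Zz by (simp add: ennreal_mult[symmetric] del: ennreal_mult)
    finally have int1: "(\<integral>\<^sup>+x. ?\<rho> x \<partial>lborel) = 1" .
    have lip: "\<bar>?\<rho> x - ?\<rho> y\<bar> \<le> B / r ^ DIM('a) * dist x y" for x y
    proof -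
      have "\<bar>?\<rho> x - ?\<rho> y\<bar> = 1 / z * \<bar>?b x - ?b y\<bar>"
        using z0 by (simp add: abs_mult flip: right_diff_distrib diff_divide_distrib)
      also have "\<dots> \<le> 1 / z * (8 * dist x y)"
        using ball_bump_lipschitz[OF r] z0 by (intro mult_left_mono) auto
      also have "\<dots> = (8 * (1 / z)) * dist x y" by simp
      also have "\<dots> \<le> B / r ^ DIM('a) * dist x y" using iz by (intro mult_right_mono) auto
      finally show ?thesis .
    qed
    show ?thesis
      unfolding spread_density_def
    proof (intro exI[of _ ?\<rho>] conjI allI impI)
      show "?\<rho> x \<le> B / r ^ DIM('a)" for x using le1[of x] iz by linarith
      show "smooth_fun ?\<rho>" by (rule smooth_fun_scaled_bump)
    qed (use sup b0 z0 int1 lip in auto)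
  qed
  with B that show ?thesis by blast
qed

section \<open>Riesz potentials of bounded densities\<close>

text \<open>
  The type argument fixes the dimension, which the value of the integral does not reveal.
\<close>

definition ball_moment :: "'a::euclidean_space itself \<Rightarrow> real \<Rightarrow> real \<Rightarrow> ennreal" where
  "ball_moment _ a R = (\<integral>\<^sup>+z\<in>cball (0::'a) R. norm z powr a \<partial>lborel)"

text \<open>
  For negative \<open>a\<close>, a point with \<open>2^(-k-1) < \<bar>z\<bar> \<le> 2^(-k)\<close> has \<open>\<bar>z\<bar> powr a \<le> 2 powr (- (k + 1) * a)\<close>,
  and the ball of radius \<open>2^(-k)\<close> has volume proportional to \<open>2^(-k * d)\<close>.  Summation over the dyadic
  scales gives a geometric series with ratio \<open>2 powr (- (a + d)) < 1\<close>.
\<close>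

lemma ball_moment_1_finite:
  assumes "- real DIM('a::euclidean_space) < a"
  shows "ball_moment TYPE('a) a 1 < \<infinity>"
proof (cases "0 \<le> a")
  case True
  have "ball_moment TYPE('a) a 1 \<le> (\<integral>\<^sup>+z. indicator (cball (0::'a) 1) z \<partial>lborel)"
    unfolding ball_moment_def
  proof (intro nn_integral_mono)
    fix z :: 'a
    show "ennreal (norm z powr a) * indicator (cball 0 1) z \<le> indicator (cball 0 1) z"
      using powr_mono2[of a "norm z" 1] True by (auto simp: indicator_def)
  qed
  also have "\<dots> < \<infinity>" using emeasure_lborel_cball_finite[of "0::'a" 1] by (simp add: top.not_eq_extremum)
  finally show ?thesis .
next
  case False
  define d where "d = DIM('a)"
  define t where "t = (1 / 2) powr (a + d)"
  have t: "0 < t" "t < 1"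
    using assms powr_less_one[of 2 "- (a + d)"] by (auto simp: t_def d_def powr_divide powr_minus_divide)
  define C where "C = 2 powr (- a) * unit_ball_vol (real d)"
  have C: "0 \<le> C" by (simp add: C_def)
  let ?f = "\<lambda>k z. ennreal (((1 / 2) ^ Suc k) powr a) * indicator (cball (0::'a) ((1 / 2) ^ k)) z"
  have "ball_moment TYPE('a) a 1 \<le> (\<integral>\<^sup>+z. (\<Sum>k. ?f k z) \<partial>lborel)"
    unfolding ball_moment_def
  proof (intro nn_integral_mono)
    fix z :: 'a
    show "ennreal (norm z powr a) * indicator (cball 0 1) z \<le> (\<Sum>k. ?f k z)"
    proof (cases "z = 0 \<or> 1 < norm z")
      case True
      then show ?thesis by auto
    next
      case F: False
      then have z: "0 < norm z" "norm z \<le> 1" by auto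
      obtain k0 where k0: "(1 / 2) ^ k0 < norm z" using real_arch_pow_inv[OF z(1), of "1/2"] by auto
      define k where "k = (LEAST k. (1 / 2) ^ Suc k < norm z)"
      have ex: "(1 / 2) ^ Suc k0 < norm z"
        using k0 z by (auto intro: less_trans[OF k0])
      have k: "(1 / 2) ^ Suc k < norm z" unfolding k_def using ex by (rule LeastI)
      have k': "norm z \<le> (1 / 2) ^ k"
      proof (cases k)
        case 0 then show ?thesis using z by simp
      next
        case (Suc j)
        then have "\<not> (1 / 2) ^ Suc j < norm z" unfolding k_def using not_less_Least[of j "\<lambda>k. (1 / 2) ^ Suc k < norm z"] by (simp del: power_Suc)
        then show ?thesis using Suc by simp
      qed
      have "norm z powr a \<le> ((1 / 2) ^ Suc k) powr a"
        using k False by (intro powr_mono2') auto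
      then have "ennreal (norm z powr a) * indicator (cball 0 1) z \<le> ?f k z"
        using k' z by (simp add: ennreal_leI)
      also have "\<dots> \<le> (\<Sum>k. ?f k z)"
      proof -
        have "sum (\<lambda>k. ?f k z) {k} \<le> (\<Sum>k. ?f k z)" by (rule sum_le_suminf) (rule summableI, simp_all)
        then show ?thesis by (simp only: sum.insert sum.empty finite.emptyI empty_iff not_False_eq_True add_0_right)
      qed
      finally show ?thesis .
    qed
  qed
  also have "\<dots> = (\<Sum>k. \<integral>\<^sup>+z. ?f k z \<partial>lborel)"
  proof (rule nn_integral_suminf)
    have [measurable]: "cball (0::'a) s \<in> sets borel" for s by simp
    show "?f k \<in> borel_measurable lborel" for k by measurable
  qed
  also have "\<dots> = (\<Sum>k. ennreal (C * t ^ k))"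
  proof (intro suminf_cong)
    fix k
    have "(\<integral>\<^sup>+z. ?f k z \<partial>lborel) = ennreal (((1 / 2) ^ Suc k) powr a) * emeasure lborel (cball (0::'a) ((1 / 2) ^ k))"
      by (simp add: nn_integral_cmult_indicator)
    also have "\<dots> = ennreal (((1 / 2) ^ Suc k) powr a * (unit_ball_vol (real d) * ((1 / 2) ^ k) ^ d))"
      by (simp add: emeasure_cball d_def ennreal_mult)
    also have "((1 / 2) ^ Suc k) powr a * (unit_ball_vol (real d) * ((1 / 2) ^ k) ^ d) = C * t ^ k"
    proof -
      have pw: "(x ^ n) powr a = (x powr a) ^ n" if "0 < x" for x :: real and n
        using that by (induction n) (simp_all add: powr_mult)
      have "((1 / 2::real) ^ Suc k) powr a = (1 / 2) powr a * ((1 / 2) powr a) ^ k"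
        unfolding power_Suc[symmetric] by (rule pw) simp
      moreover have "2 powr (- a) = (1 / 2::real) powr a"
        by (simp add: powr_divide powr_minus_divide)
      moreover have "((1 / 2::real) ^ k) ^ d = ((1 / 2) powr d) ^ k"
        by (simp add: powr_realpow power_mult[symmetric] mult.commute)
      moreover have "t ^ k = ((1 / 2) powr a) ^ k * ((1 / 2) powr d) ^ k"
        unfolding t_def powr_add power_mult_distrib ..
      ultimately show ?thesis unfolding C_def by (simp only: mult_ac)
    qed
    finally show "(\<integral>\<^sup>+z. ?f k z \<partial>lborel) = ennreal (C * t ^ k)" .
  qed
  also have "\<dots> = ennreal (\<Sum>k. C * t ^ k)"
    using t C by (intro suminf_ennreal2 summable_mult summable_geometric) auto
  also have "\<dots> < \<infinity>" by simp
  finally show ?thesis .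
qed

lemma ball_moment_le:
  assumes "a \<le> 0" "1 \<le> R"
  shows "ball_moment TYPE('a::euclidean_space) a R
           \<le> ball_moment TYPE('a) a 1 + ennreal (unit_ball_vol (real DIM('a)) * R ^ DIM('a))"
proof -
  have [measurable]: "cball (0::'a) r \<in> sets borel" for r by simp
  have "ball_moment TYPE('a) a R \<le>
     (\<integral>\<^sup>+z. ennreal (norm z powr a) * indicator (cball (0::'a) 1) z + indicator (cball 0 R) z \<partial>lborel)"
    unfolding ball_moment_def
  proof (intro nn_integral_mono)
    fix z :: 'a
    show "ennreal (norm z powr a) * indicator (cball 0 R) z
      \<le> ennreal (norm z powr a) * indicator (cball 0 1) z + indicator (cball 0 R) z"
      using powr_mono2'[of a 1 "norm z"] assms by (auto simp: indicator_def)
  qed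
  also have "\<dots> = ball_moment TYPE('a) a 1 + emeasure lborel (cball (0::'a) R)"
    unfolding ball_moment_def
    by (simp add: nn_integral_add)
  finally show ?thesis using assms by (simp add: emeasure_cball)
qed

lemma nn_integral_lborel_reflect:
  fixes f :: "'a::euclidean_space \<Rightarrow> ennreal"
  assumes [measurable]: "f \<in> borel_measurable borel"
  shows "(\<integral>\<^sup>+y. f (x - y) \<partial>lborel) = (\<integral>\<^sup>+z. f z \<partial>lborel)"
  by (subst (2) lborel_affine[of "-1" x]) (simp_all add: nn_integral_density nn_integral_distr)

lemma integral_lborel_reflect:
  fixes f :: "'a::euclidean_space \<Rightarrow> 'b::{banach, second_countable_topology}"
  assumes [measurable]: "f \<in> borel_measurable borel"
  shows "(LINT y|lborel. f (x - y)) = (LINT z|lborel. f z)"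
  by (subst (2) lborel_affine[of "-1" x]) (simp_all add: density_1 integral_distr)

text \<open>
  Within distance \<open>R\<close> of \<open>x\<close> the density is replaced by its height, farther away the kernel is replaced
  by its largest value on the support of the density.
\<close>

lemma potential_of_bounded_density_le:
  fixes \<rho> :: "'a::euclidean_space \<Rightarrow> real"
  assumes [measurable]: "\<rho> \<in> borel_measurable borel"
    and rho: "\<And>y. 0 \<le> \<rho> y" "\<And>y. \<rho> y \<le> M" "(\<integral>\<^sup>+y. \<rho> y \<partial>lborel) \<le> 1"
    and far: "\<And>y. \<rho> y \<noteq> 0 \<Longrightarrow> R < norm (x - y) \<Longrightarrow> norm (x - y) powr a \<le> B"
    and "0 \<le> B"
  shows "(\<integral>\<^sup>+y. ennreal (\<rho> y) * ennreal (norm (x - y) powr a) \<partial>lborel)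
           \<le> ennreal M * ball_moment TYPE('a) a R + ennreal B"
proof -
  have [measurable]: "cball (0::'a) R \<in> sets borel" by simp
  have "(\<integral>\<^sup>+y. ennreal (\<rho> y) * ennreal (norm (x - y) powr a) \<partial>lborel) \<le>
    (\<integral>\<^sup>+y. ennreal M * (ennreal (norm (x - y) powr a) * indicator (cball 0 R) (x - y)) + ennreal B * \<rho> y \<partial>lborel)"
  proof (intro nn_integral_mono)
    fix y
    show "ennreal (\<rho> y) * ennreal (norm (x - y) powr a) \<le>
      ennreal M * (ennreal (norm (x - y) powr a) * indicator (cball 0 R) (x - y)) + ennreal B * \<rho> y"
    proof (cases "norm (x - y) \<le> R")
      case True
      have "ennreal (\<rho> y) * ennreal (norm (x - y) powr a) \<le> ennreal M * ennreal (norm (x - y) powr a)"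
        using rho(2) by (intro mult_right_mono ennreal_leI) auto
      then show ?thesis using True by (simp add: add_increasing2)
    next
      case False
      have "ennreal (\<rho> y) * ennreal (norm (x - y) powr a) \<le> ennreal (\<rho> y) * ennreal B"
        using far[of y] False by (cases "\<rho> y = 0") (auto intro!: mult_left_mono ennreal_leI)
      then show ?thesis using False by (simp add: mult.commute)
    qed
  qed
  also have "\<dots> = ennreal M * (\<integral>\<^sup>+y. ennreal (norm (x - y) powr a) * indicator (cball 0 R) (x - y) \<partial>lborel)
                  + ennreal B * (\<integral>\<^sup>+y. \<rho> y \<partial>lborel)"
    by (simp add: nn_integral_add nn_integral_cmult)
  also have "(\<integral>\<^sup>+y. ennreal (norm (x - y) powr a) * indicator (cball 0 R) (x - y) \<partial>lborel) = ball_moment TYPE('a) a R"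
    unfolding ball_moment_def
    by (rule nn_integral_lborel_reflect[of "\<lambda>z. ennreal (norm z powr a) * indicator (cball 0 R) z"]) simp
  also have "ennreal B * (\<integral>\<^sup>+y. \<rho> y \<partial>lborel) \<le> ennreal B"
    using rho(3) mult_left_mono[of "\<integral>\<^sup>+y. \<rho> y \<partial>lborel" 1 "ennreal B"] by simp
  finally show ?thesis by (simp add: add_left_mono)
qed

section \<open>Fields of bounded densities\<close>

lemma norm_grad_riesz_kernel: "norm (grad_riesz_kernel q z) = norm z powr (q - 1)"
proof (cases "z = 0")
  case False
  have "norm z powr (q - 1) = norm z powr (q - 2) * norm z powr 1" by (simp only: flip: powr_add) simp
  then show ?thesis using False by (simp add: grad_riesz_kernel_def)
qed (simp add: grad_riesz_kernel_def)

lemma measurable_grad_riesz_kernel[measurable]: "grad_riesz_kernel q \<in> borel_measurable borel"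
  unfolding grad_riesz_kernel_def by measurable

lemma convolution_field_bound:
  fixes \<rho> :: "'a::euclidean_space \<Rightarrow> real"
  assumes [measurable]: "\<rho> \<in> borel_measurable borel"
    and rho: "\<And>y. 0 \<le> \<rho> y"
    and le: "(\<integral>\<^sup>+y. ennreal (\<rho> y) * ennreal (norm (x - y) powr (q - 1)) \<partial>lborel) \<le> ennreal K" and "0 \<le> K"
  shows "integrable lborel (\<lambda>y. \<rho> y *\<^sub>R grad_riesz_kernel q (x - y))"
    and "norm (LINT y|lborel. \<rho> y *\<^sub>R grad_riesz_kernel q (x - y)) \<le> K"
proof -
  have eq: "(\<integral>\<^sup>+y. norm (\<rho> y *\<^sub>R grad_riesz_kernel q (x - y)) \<partial>lborel)
      = (\<integral>\<^sup>+y. ennreal (\<rho> y) * ennreal (norm (x - y) powr (q - 1)) \<partial>lborel)"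
    using rho by (intro nn_integral_cong) (simp add: norm_grad_riesz_kernel ennreal_mult)
  show int: "integrable lborel (\<lambda>y. \<rho> y *\<^sub>R grad_riesz_kernel q (x - y))"
    using le unfolding eq[symmetric]
    by (intro integrableI_bounded) (auto intro: le_less_trans)
  have "ennreal (norm (LINT y|lborel. \<rho> y *\<^sub>R grad_riesz_kernel q (x - y))) \<le> ennreal K"
    using integral_norm_bound_ennreal[OF int] le unfolding eq by (rule order_trans)
  then show "norm (LINT y|lborel. \<rho> y *\<^sub>R grad_riesz_kernel q (x - y)) \<le> K"
    using \<open>0 \<le> K\<close> by simp
qed

text \<open>
  The principal value as an absolutely convergent integral: subtracting \<open>\<rho> x\<close> on the unit ball does
  not change the truncated integrals, because the kernel is odd, and it tames the singularity.
\<close>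

definition pv_integrand :: "real \<Rightarrow> ('a::euclidean_space \<Rightarrow> real) \<Rightarrow> 'a \<Rightarrow> 'a \<Rightarrow> 'a" where
  "pv_integrand q \<rho> x z = (\<rho> (x - z) - indicator (cball 0 1) z * \<rho> x) *\<^sub>R grad_riesz_kernel q z"

lemma measurable_pv_integrand:
  fixes \<rho> :: "'a::euclidean_space \<Rightarrow> real"
  assumes [measurable]: "\<rho> \<in> borel_measurable borel"
  shows "(\<lambda>(x, z). pv_integrand q \<rho> x z) \<in> borel_measurable (borel \<Otimes>\<^sub>M borel)"
proof -
  have [measurable]: "cball (0::'a) 1 \<in> sets borel" by simp
  show ?thesis unfolding pv_integrand_def by measurable
qed

text \<open>
  On the unit ball the Lipschitz bound makes the integrand at most \<open>M * \<bar>z\<bar> powr q\<close>.  Between the radii \<open>1\<close>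
  and \<open>R\<close> the kernel is at most \<open>1\<close> and the density at most \<open>M\<close>; beyond \<open>R\<close> the kernel is at most
  \<open>R powr q\<close> and the density has mass at most \<open>1\<close>.
\<close>

lemma pv_integrand_bound:
  fixes \<rho> :: "'a::euclidean_space \<Rightarrow> real"
  assumes [measurable]: "\<rho> \<in> borel_measurable borel"
    and rho: "\<And>y. 0 \<le> \<rho> y" "\<And>y. \<rho> y \<le> M" "(\<integral>\<^sup>+y. \<rho> y \<partial>lborel) \<le> 1"
    and lip: "\<And>x y. \<bar>\<rho> x - \<rho> y\<bar> \<le> M * dist x y"
    and "q < 0" "1 \<le> R"
  shows "(\<integral>\<^sup>+z. norm (pv_integrand q \<rho> x z) \<partial>lborel)
     \<le> ennreal M * (ball_moment TYPE('a) q 1 + ennreal (unit_ball_vol (real DIM('a)) * R ^ DIM('a)))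
         + ennreal (R powr q)"
proof -
  have [measurable]: "cball (0::'a) r \<in> sets borel" for r by simp
  have M: "0 \<le> M" using rho(1)[of x] rho(2)[of x] by linarith
  have "(\<integral>\<^sup>+z. norm (pv_integrand q \<rho> x z) \<partial>lborel) \<le>
    (\<integral>\<^sup>+z. ennreal M * (ennreal (norm z powr q) * indicator (cball 0 1) z + indicator (cball 0 R) z)
         + ennreal (R powr q) * ennreal (\<rho> (x - z)) \<partial>lborel)"
  proof (intro nn_integral_mono)
    fix z :: 'a
    show "ennreal (norm (pv_integrand q \<rho> x z)) \<le>
      ennreal M * (ennreal (norm z powr q) * indicator (cball 0 1) z + indicator (cball 0 R) z)
         + ennreal (R powr q) * ennreal (\<rho> (x - z))"
    proof (cases "norm z \<le> 1")
      case True
      have "norm (pv_integrand q \<rho> x z) = \<bar>\<rho> (x - z) - \<rho> x\<bar> * norm z powr (q - 1)"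
        using True by (simp add: pv_integrand_def norm_grad_riesz_kernel)
      also have "\<dots> \<le> (M * norm z) * norm z powr (q - 1)"
        using lip[of "x - z" x] by (intro mult_right_mono) (auto simp: dist_norm)
      also have "\<dots> = M * (norm z powr 1 * norm z powr (q - 1))" by simp
      also have "\<dots> = M * norm z powr q" by (simp only: flip: powr_add) simp
      finally have "ennreal (norm (pv_integrand q \<rho> x z)) \<le> ennreal M * ennreal (norm z powr q)"
        using M by (simp add: ennreal_mult[symmetric] ennreal_leI)
      then show ?thesis using True by (simp add: distrib_left add_increasing2)
    next
      case False
      then have n: "norm (pv_integrand q \<rho> x z) = \<rho> (x - z) * norm z powr (q - 1)"
        using rho(1) by (simp add: pv_integrand_def norm_grad_riesz_kernel)
      have le1: "norm z powr (q - 1) \<le> 1"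
        using False powr_mono2'[of "q - 1" 1 "norm z"] \<open>q < 0\<close> by simp
      show ?thesis
      proof (cases "norm z \<le> R")
        case True
        have "\<rho> (x - z) * norm z powr (q - 1) \<le> M * 1"
          using rho le1 M by (intro mult_mono) auto
        then show ?thesis using False True n by (simp add: add_increasing2 ennreal_leI)
      next
        case F: False
        have "norm z powr (q - 1) \<le> norm z powr q" using False by (intro powr_mono) auto
        also have "\<dots> \<le> R powr q" using F \<open>1 \<le> R\<close> \<open>q < 0\<close> by (intro powr_mono2') auto
        finally have "\<rho> (x - z) * norm z powr (q - 1) \<le> \<rho> (x - z) * R powr q"
          using rho(1) by (rule mult_left_mono)
        then have "\<rho> (x - z) * norm z powr (q - 1) \<le> R powr q * \<rho> (x - z)"
          by (simp only: mult.commute)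
        then show ?thesis using F False n rho(1)
          by (simp add: ennreal_mult[symmetric] ennreal_leI)
      qed
    qed
  qed
  also have "\<dots> = ennreal M * (ball_moment TYPE('a) q 1 + emeasure lborel (cball (0::'a) R))
         + ennreal (R powr q) * (\<integral>\<^sup>+z. ennreal (\<rho> (x - z)) \<partial>lborel)"
    unfolding ball_moment_def by (simp add: nn_integral_add nn_integral_cmult)
  also have "(\<integral>\<^sup>+z. ennreal (\<rho> (x - z)) \<partial>lborel) = (\<integral>\<^sup>+y. \<rho> y \<partial>lborel)"
    by (rule nn_integral_lborel_reflect[of "\<lambda>y. ennreal (\<rho> y)"]) simp
  also have "ennreal (R powr q) * (\<integral>\<^sup>+y. \<rho> y \<partial>lborel) \<le> ennreal (R powr q)"
    using rho(3) mult_left_mono[of "\<integral>\<^sup>+y. \<rho> y \<partial>lborel" 1 "ennreal (R powr q)"] by simp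
  finally show ?thesis using \<open>1 \<le> R\<close> by (simp add: emeasure_cball add_left_mono)
qed

text \<open>
  The reflection \<open>z \<mapsto> - z\<close> preserves the annulus and changes the sign of the kernel.
\<close>

lemma annulus_kernel_integral:
  assumes "0 < \<epsilon>"
  shows "integrable lborel (\<lambda>z::'a::euclidean_space.
            indicator ({z. \<epsilon> < norm z} \<inter> cball 0 1) z *\<^sub>R grad_riesz_kernel q z)" (is "integrable _ ?h")
    and "(LINT z|lborel. indicator ({z::'a. \<epsilon> < norm z} \<inter> cball 0 1) z *\<^sub>R grad_riesz_kernel q z) = 0"
proof -
  let ?A = "{z::'a. \<epsilon> < norm z} \<inter> cball 0 1"
  have A[measurable]: "?A \<in> sets borel"
    by (intro sets.Int borel_closed closed_cball borel_open open_Collect_less continuous_intros)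
  have fin: "emeasure lborel ?A < \<infinity>"
    using emeasure_mono[of ?A "cball 0 1" lborel] emeasure_lborel_cball_finite[of "0::'a" 1]
    by (auto simp: top.not_eq_extremum intro: le_less_trans)
  have m: "?h \<in> borel_measurable lborel" by simp
  have "norm (?h z) \<le> max 1 (\<epsilon> powr (q - 1)) * indicator ?A z" for z
  proof (cases "z \<in> ?A")
    case True
    then have "norm z powr (q - 1) \<le> max 1 (\<epsilon> powr (q - 1))"
      using powr_mono2[of "q - 1" "norm z" 1] powr_mono2'[of "q - 1" \<epsilon> "norm z"] assms
      by (cases "0 \<le> q - 1") auto
    then show ?thesis using True by (simp add: norm_grad_riesz_kernel)
  qed auto
  then show int: "integrable lborel ?h"
  proof (intro Bochner_Integration.integrable_bound[OF _ m AE_I2])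
    show "integrable lborel (\<lambda>z. max 1 (\<epsilon> powr (q - 1)) * indicator ?A z)"
      using fin by (intro integrable_mult_right integrable_real_indicator) simp_all
  qed (auto intro: order_trans[OF _ abs_ge_self])
  have "integral\<^sup>L lborel ?h = (LINT z|lborel. ?h (0 - z))"
    using m by (intro integral_lborel_reflect[symmetric]) simp
  also have "(\<lambda>z. ?h (0 - z)) = (\<lambda>z. - ?h z)"
    by (auto simp: indicator_def grad_riesz_kernel_def)
  also have "(LINT z|lborel. - ?h z) = - integral\<^sup>L lborel ?h" by simp
  finally have "2 *\<^sub>R integral\<^sup>L lborel ?h = 0" by (simp add: scaleR_2 eq_neg_iff_add_eq_0)
  then show "integral\<^sup>L lborel ?h = 0" by simp
qed

text \<open>
  By the vanishing integral over annuli, the truncated convolution is the integral of the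
  regularised integrand outside the ball of radius \<open>\<epsilon>\<close>; dominated convergence does the rest.
\<close>

lemma pv_truncation_tendsto:
  fixes \<rho> :: "'a::euclidean_space \<Rightarrow> real"
  assumes [measurable]: "\<rho> \<in> borel_measurable borel"
    and int: "integrable lborel (pv_integrand q \<rho> x)"
  shows "(pv_truncation q \<rho> x \<longlongrightarrow> (LINT z|lborel. pv_integrand q \<rho> x z)) (at_right 0)"
proof -
  have Am[measurable]: "{z::'a. \<epsilon> < norm z} \<in> sets borel" for \<epsilon>
    by (intro borel_open open_Collect_less continuous_intros)
  have eq: "pv_truncation q \<rho> x \<epsilon> = (LINT z|lborel. indicator {z. \<epsilon> < norm z} z *\<^sub>R pv_integrand q \<rho> x z)"
    if "0 < \<epsilon>" for \<epsilon>
  proof -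
    let ?h = "\<lambda>z::'a. indicator ({z. \<epsilon> < norm z} \<inter> cball 0 1) z *\<^sub>R grad_riesz_kernel q z"
    have "(LINT z|lborel. indicator {z. \<epsilon> < norm z} z *\<^sub>R pv_integrand q \<rho> x z)
       = (LINT z|lborel. indicator {z. \<epsilon> < norm z} z *\<^sub>R pv_integrand q \<rho> x z) + \<rho> x *\<^sub>R (LINT z|lborel. ?h z)"
      using annulus_kernel_integral(2)[OF that, where 'a = 'a] by simp
    also have "\<dots> = (LINT z|lborel. indicator {z. \<epsilon> < norm z} z *\<^sub>R pv_integrand q \<rho> x z + \<rho> x *\<^sub>R ?h z)"
      using int annulus_kernel_integral(1)[OF that, where 'a = 'a]
      by (subst Bochner_Integration.integral_add)
        (auto intro!: integrable_mult_indicator integrable_scaleR_right simp del: scaleR_scaleR)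
    also have "\<dots> = pv_truncation q \<rho> x \<epsilon>"
      unfolding pv_truncation_def set_lebesgue_integral_def
      by (intro Bochner_Integration.integral_cong) (auto simp: pv_integrand_def indicator_def algebra_simps)
    finally show ?thesis by simp
  qed
  show ?thesis
  proof (rule tendsto_at_right_sequentially[OF zero_less_one])
    fix S :: "nat \<Rightarrow> real"
    assume S: "\<And>n. 0 < S n" "S \<longlonglongrightarrow> 0"
    have "(\<lambda>n. LINT z|lborel. indicator {z. S n < norm z} z *\<^sub>R pv_integrand q \<rho> x z)
            \<longlonglongrightarrow> (LINT z|lborel. pv_integrand q \<rho> x z)"
    proof (rule integral_dominated_convergence[where w = "\<lambda>z. norm (pv_integrand q \<rho> x z)"])
      show "AE z in lborel. (\<lambda>n. indicator {z. S n < norm z} z *\<^sub>R pv_integrand q \<rho> x z) \<longlonglongrightarrow> pv_integrand q \<rho> x z"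
      proof (rule AE_I2)
        fix z :: 'a
        show "(\<lambda>n. indicator {z. S n < norm z} z *\<^sub>R pv_integrand q \<rho> x z) \<longlonglongrightarrow> pv_integrand q \<rho> x z"
        proof (cases "z = 0")
          case True
          then show ?thesis by (simp add: pv_integrand_def grad_riesz_kernel_def)
        next
          case False
          then have "\<forall>\<^sub>F n in sequentially. S n < norm z"
            using order_tendstoD(2)[OF S(2), of "norm z"] by simp
          then have "\<forall>\<^sub>F n in sequentially. pv_integrand q \<rho> x z = indicator {z. S n < norm z} z *\<^sub>R pv_integrand q \<rho> x z"
            by eventually_elim simp
          then show ?thesis by (rule Lim_transform_eventually[OF tendsto_const])
        qed
      qed
      show "integrable lborel (\<lambda>z. norm (pv_integrand q \<rho> x z))" using int by simp
      have m: "pv_integrand q \<rho> x \<in> borel_measurable borel" using int by simp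
      then show "pv_integrand q \<rho> x \<in> borel_measurable lborel" by simp
      show "(\<lambda>z. indicator {z. S n < norm z} z *\<^sub>R pv_integrand q \<rho> x z) \<in> borel_measurable lborel" for n
        using m by simp
    qed (auto simp: indicator_def)
    then show "(\<lambda>n. pv_truncation q \<rho> x (S n)) \<longlonglongrightarrow> (LINT z|lborel. pv_integrand q \<rho> x z)"
      by (simp add: eq S(1))
  qed
qed

text \<open>
  The common bound for the potential of exponent \<open>a\<close> and for the field of a density of height and
  Lipschitz constant at most \<open>M\<close>, obtained by splitting at the radius \<open>R\<close>.
\<close>

definition spread_bound :: "'a::euclidean_space itself \<Rightarrow> real \<Rightarrow> real \<Rightarrow> real \<Rightarrow> real" where
  "spread_bound _ a M R =
     M * (enn2real (ball_moment TYPE('a) a 1) + unit_ball_vol (real DIM('a)) * R ^ DIM('a)) + R powr a"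

lemma spread_bound_ennreal:
  assumes "- real DIM('a::euclidean_space) < a" "0 \<le> M" "0 \<le> R"
  shows "ennreal M * (ball_moment TYPE('a) a 1 + ennreal (unit_ball_vol (real DIM('a)) * R ^ DIM('a)))
         + ennreal (R powr a) = ennreal (spread_bound TYPE('a) a M R)"
proof -
  obtain b where b: "ball_moment TYPE('a) a 1 = ennreal b" "0 \<le> b"
    using ball_moment_1_finite[OF assms(1)] by (cases "ball_moment TYPE('a) a 1") auto
  define w where "w = unit_ball_vol (real DIM('a)) * R ^ DIM('a)"
  have w: "0 \<le> w" using assms(3) by (simp add: w_def)
  have "enn2real (ball_moment TYPE('a) a 1) = b" using b by simp
  then have "spread_bound TYPE('a) a M R = M * (b + w) + R powr a"
    by (simp add: spread_bound_def w_def)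
  then show ?thesis
    using assms(2) b(2) w unfolding b(1) w_def[symmetric]
    by (simp add: ennreal_mult)
qed

lemma spread_bound_nonneg: "0 \<le> M \<Longrightarrow> 0 \<le> R \<Longrightarrow> 0 \<le> spread_bound TYPE('a::euclidean_space) a M R"
  unfolding spread_bound_def by (intro add_nonneg_nonneg mult_nonneg_nonneg) auto

lemma potential_le_spread_bound:
  fixes \<rho> :: "'a::euclidean_space \<Rightarrow> real"
  assumes "\<rho> \<in> borel_measurable borel"
    and rho: "\<And>y. 0 \<le> \<rho> y" "\<And>y. \<rho> y \<le> M" "(\<integral>\<^sup>+y. \<rho> y \<partial>lborel) \<le> 1"
    and a: "- real DIM('a) < a" "a < 0" and R: "1 \<le> R"
  shows "(\<integral>\<^sup>+y. ennreal (\<rho> y) * ennreal (norm (x - y) powr a) \<partial>lborel) \<le> ennreal (spread_bound TYPE('a) a M R)"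
proof -
  have "0 \<le> M" using rho(1)[of x] rho(2)[of x] by linarith
  have "(\<integral>\<^sup>+y. ennreal (\<rho> y) * ennreal (norm (x - y) powr a) \<partial>lborel)
      \<le> ennreal M * ball_moment TYPE('a) a R + ennreal (R powr a)"
    using a R by (intro potential_of_bounded_density_le assms powr_mono2') auto
  also have "\<dots> \<le> ennreal (spread_bound TYPE('a) a M R)"
    using ball_moment_le[of a R, where 'a = 'a] a R \<open>0 \<le> M\<close>
    by (subst spread_bound_ennreal[symmetric]) (auto intro!: add_right_mono mult_left_mono)
  finally show ?thesis .
qed

text \<open>
  The exponent in the bound is that of the kernel, \<open>q - 1\<close>, as long as this is locally integrable; in
  the principal value regime the Lipschitz continuity of \<open>\<rho>\<close> gains one power.
\<close>

lemma source_field_spread: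
  fixes \<rho> :: "'a::euclidean_space \<Rightarrow> real"
  assumes [measurable]: "\<rho> \<in> borel_measurable borel"
    and rho: "\<And>y. 0 \<le> \<rho> y" "\<And>y. \<rho> y \<le> M" "(\<integral>\<^sup>+y. \<rho> y \<partial>lborel) \<le> 1"
    and lip: "\<And>x y. \<bar>\<rho> x - \<rho> y\<bar> \<le> M * dist x y"
    and q: "- real DIM('a) < q" "q < 0" and R: "1 \<le> R"
  defines "a \<equiv> if 1 - real DIM('a) < q then q - 1 else q"
  shows "source_field_defined q \<rho> x"
    and "norm (source_field q \<rho> x) \<le> spread_bound TYPE('a) a M R"
    and "source_field q \<rho> \<in> borel_measurable borel"
proof -
  have M: "0 \<le> M" using rho(1)[of x] rho(2)[of x] by linarith
  have nn: "0 \<le> spread_bound TYPE('a) a M R" using M R by (intro spread_bound_nonneg) auto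
  have "source_field_defined q \<rho> x \<and> norm (source_field q \<rho> x) \<le> spread_bound TYPE('a) a M R \<and>
     source_field q \<rho> \<in> borel_measurable borel"
  proof (cases "1 - real DIM('a) < q")
    case True
    have "(\<integral>\<^sup>+y. ennreal (\<rho> y) * ennreal (norm (x - y) powr (q - 1)) \<partial>lborel) \<le> ennreal (spread_bound TYPE('a) a M R)"
      unfolding a_def using True q R by (simp, intro potential_le_spread_bound rho) auto
    note conv = convolution_field_bound[OF assms(1) rho(1) this nn]
    have [measurable]: "source_field q \<rho> \<in> borel_measurable borel"
      unfolding source_field_def[abs_def] using True by simp
    then show ?thesis
      using conv True by (simp add: source_field_def source_field_defined_def)
  next
    case False
    have pm[measurable]: "(\<lambda>(x, z). pv_integrand q \<rho> x z) \<in> borel_measurable (borel \<Otimes>\<^sub>M lborel)"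
      using measurable_pv_integrand[of \<rho> q] by simp
    have le: "(\<integral>\<^sup>+z. norm (pv_integrand q \<rho> x z) \<partial>lborel) \<le> ennreal (spread_bound TYPE('a) a M R)" for x
      unfolding a_def using False pv_integrand_bound[OF assms(1) rho lip q(2) R, of x]
      by (simp add: spread_bound_ennreal[OF q(1) M] R order_trans[OF zero_le_one R])
    have int: "integrable lborel (pv_integrand q \<rho> x)" for x
      using le[of x] by (intro integrableI_bounded) (auto intro: le_less_trans)
    note lim = pv_truncation_tendsto[OF assms(1) int]
    have eq: "source_field q \<rho> x = (LINT z|lborel. pv_integrand q \<rho> x z)" for x
      unfolding source_field_def using False tendsto_Lim[OF _ lim[of x]] by simp
    have "ennreal (norm (LINT z|lborel. pv_integrand q \<rho> x z)) \<le> ennreal (spread_bound TYPE('a) a M R)"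
      using integral_norm_bound_ennreal[OF int] le by (rule order_trans)
    then have "norm (LINT z|lborel. pv_integrand q \<rho> x z) \<le> spread_bound TYPE('a) a M R" using nn by simp
    moreover have "source_field q \<rho> \<in> borel_measurable borel"
      unfolding eq[abs_def] by measurable
    ultimately show ?thesis
      using lim[of x] False by (auto simp: eq source_field_defined_def)
  qed
  then show "source_field_defined q \<rho> x" "norm (source_field q \<rho> x) \<le> spread_bound TYPE('a) a M R"
    "source_field q \<rho> \<in> borel_measurable borel" by auto
qed

text \<open>
  Any splitting radius that tends to infinity more slowly than \<open>r\<close> would serve; with \<open>sqrt r\<close> the near
  part is \<open>O((1 / sqrt r) ^ d)\<close>.
\<close>

lemma spread_bound_tendsto_0:
  assumes a: "- real DIM('a::euclidean_space) < a" "a < 0"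
  shows "((\<lambda>r. spread_bound TYPE('a) a (B / r ^ DIM('a)) (sqrt r)) \<longlongrightarrow> 0) at_top"
proof -
  let ?d = "DIM('a)"
  let ?I = "enn2real (ball_moment TYPE('a) a 1)" and ?v = "unit_ball_vol (real DIM('a))"
  have pos: "0 < ?d" by simp
  have i: "((\<lambda>r::real. (1 / r) ^ ?d) \<longlongrightarrow> 0) at_top"
    using tendsto_power[OF tendsto_inverse_0_at_top[OF filterlim_ident], of ?d]
    by (simp only: inverse_eq_divide zero_power[OF pos])
  have s: "((\<lambda>r::real. (1 / sqrt r) ^ ?d) \<longlongrightarrow> 0) at_top"
    using tendsto_power[OF tendsto_inverse_0_at_top[OF sqrt_at_top], of ?d]
    by (simp only: inverse_eq_divide zero_power[OF pos])
  have p: "((\<lambda>r::real. sqrt r powr a) \<longlongrightarrow> 0) at_top"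
    using tendsto_neg_powr[OF a(2) sqrt_at_top] .
  have "((\<lambda>r. B * ?I * (1 / r) ^ ?d + B * ?v * (1 / sqrt r) ^ ?d + sqrt r powr a) \<longlongrightarrow> B * ?I * 0 + B * ?v * 0 + 0) at_top"
    by (intro tendsto_intros i s p)
  moreover have "\<forall>\<^sub>F r in at_top. B * ?I * (1 / r) ^ ?d + B * ?v * (1 / sqrt r) ^ ?d + sqrt r powr a
      = spread_bound TYPE('a) a (B / r ^ DIM('a)) (sqrt r)"
    using eventually_gt_at_top[of 0]
  proof eventually_elim
    fix r :: real assume r: "0 < r"
    have "(1 / sqrt r) ^ ?d = sqrt r ^ ?d / r ^ ?d"
    proof -
      have "1 / sqrt r = sqrt r / r" using r real_sqrt_mult_self[of r] by (simp add: frac_eq_eq)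
      then show ?thesis by (simp only: power_divide)
    qed
    then show "B * ?I * (1 / r) ^ ?d + B * ?v * (1 / sqrt r) ^ ?d + sqrt r powr a
      = spread_bound TYPE('a) a (B / r ^ DIM('a)) (sqrt r)"
      by (simp add: spread_bound_def power_one_over distrib_left add_divide_distrib mult.assoc)
  qed
  ultimately show ?thesis using Lim_transform_eventually by fastforce
qed

section \<open>Energies as double integrals\<close>

lemma measurable_dist_pow[measurable]:
  "(\<lambda>(x, y). dist_pow q x y) \<in> borel_measurable (borel \<Otimes>\<^sub>M borel :: ('a::euclidean_space \<times> 'a) measure)"
proof -
  have "dist_pow q x y = (if q < 0 \<and> dist x y = 0 then \<infinity> else ennreal (dist x y powr q))" for x y :: 'a
    by (simp add: dist_pow_def)
  then show ?thesis by simp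
qed

lemma dist_pow_commute: "dist_pow q x y = dist_pow q y x"
  by (auto simp: dist_pow_def dist_commute)

lemma borel_probD:
  assumes "borel_prob \<mu>"
  shows "prob_space \<mu>" "sets \<mu> = sets borel" "sigma_finite_measure \<mu>"
  using assms prob_space_imp_sigma_finite by (auto simp: borel_prob_def)

lemma borel_prob_density_measure:
  assumes "\<rho> \<in> borel_measurable borel" "(\<integral>\<^sup>+x. \<rho> x \<partial>lborel) = 1"
  shows "borel_prob (density_measure \<rho>)"
  using assms by (auto simp: borel_prob_def emeasure_density intro!: prob_spaceI)

lemma AE_density_measure_support:
  fixes \<rho> :: "'a::euclidean_space \<Rightarrow> real"
  assumes "\<rho> \<in> borel_measurable borel" "\<And>x. \<rho> x \<noteq> 0 \<Longrightarrow> P x"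
  shows "AE x in density_measure \<rho>. P x"
  using assms by (subst AE_density) auto

text \<open>
  The complement of the support is a union of open null sets, and by the Lindelof property countably
  many of them suffice.
\<close>

lemma AE_in_measure_support:
  fixes \<mu> :: "'a::euclidean_space measure"
  assumes "sets \<mu> = sets borel"
  shows "AE x in \<mu>. x \<in> measure_support \<mu>"
proof -
  define N where "N = {U. open U \<and> emeasure \<mu> U = 0}"
  obtain N' where N': "N' \<subseteq> N" "countable N'" "\<Union>N' = \<Union>N"
    using Lindelof[of N] unfolding N_def by auto
  have sub: "- measure_support \<mu> \<subseteq> \<Union>N'"
    unfolding N'(3) by (auto simp: measure_support_def N_def not_gr_zero)
  have "U \<in> null_sets \<mu>" if "U \<in> N'" for U
    using that N'(1) assms by (auto simp: N_def null_sets_def)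
  then have "\<Union>N' \<in> null_sets \<mu>"
    using null_sets_UN'[OF N'(2), of "\<lambda>U. U" \<mu>] by simp
  then show ?thesis using sub by (auto intro!: AE_I')
qed

lemma pow_integral_commute:
  fixes \<alpha> \<beta> :: "'a::euclidean_space measure"
  assumes "borel_prob \<alpha>" "borel_prob \<beta>"
  shows "pow_integral q \<alpha> \<beta> = pow_integral q \<beta> \<alpha>"
proof -
  interpret pair_sigma_finite \<alpha> \<beta>
    using borel_probD[OF assms(1)] borel_probD[OF assms(2)] by (simp add: pair_sigma_finite_def)
  note [measurable_cong] = borel_probD(2)[OF assms(1)] borel_probD(2)[OF assms(2)]
  show ?thesis
    unfolding pow_integral_def by (subst Fubini') (auto simp: dist_pow_commute)
qed

lemma pow_integral_leI:
  assumes "prob_space \<alpha>" "prob_space \<beta>" "AE x in \<alpha>. AE y in \<beta>. dist_pow q x y \<le> c"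
  shows "pow_integral q \<alpha> \<beta> \<le> c"
proof -
  interpret A: prob_space \<alpha> by fact
  interpret B: prob_space \<beta> by fact
  have "pow_integral q \<alpha> \<beta> \<le> (\<integral>\<^sup>+x. c \<partial>\<alpha>)"
    unfolding pow_integral_def
  proof (intro nn_integral_mono_AE, use assms(3) in eventually_elim)
    fix x assume "AE y in \<beta>. dist_pow q x y \<le> c"
    then have "(\<integral>\<^sup>+y. dist_pow q x y \<partial>\<beta>) \<le> (\<integral>\<^sup>+y. c \<partial>\<beta>)" by (rule nn_integral_mono_AE)
    then show "(\<integral>\<^sup>+y. dist_pow q x y \<partial>\<beta>) \<le> c" by (simp add: B.emeasure_space_1)
  qed
  then show ?thesis by (simp add: A.emeasure_space_1)
qed

lemma pow_integral_geI:
  assumes "prob_space \<alpha>" "prob_space \<beta>" "AE x in \<alpha>. AE y in \<beta>. c \<le> dist_pow q x y"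
  shows "c \<le> pow_integral q \<alpha> \<beta>"
proof -
  interpret A: prob_space \<alpha> by fact
  interpret B: prob_space \<beta> by fact
  have "(\<integral>\<^sup>+x. c \<partial>\<alpha>) \<le> pow_integral q \<alpha> \<beta>"
    unfolding pow_integral_def
  proof (intro nn_integral_mono_AE, use assms(3) in eventually_elim)
    fix x assume "AE y in \<beta>. c \<le> dist_pow q x y"
    then have "(\<integral>\<^sup>+y. c \<partial>\<beta>) \<le> (\<integral>\<^sup>+y. dist_pow q x y \<partial>\<beta>)" by (rule nn_integral_mono_AE)
    then show "c \<le> (\<integral>\<^sup>+y. dist_pow q x y \<partial>\<beta>)" by (simp add: B.emeasure_space_1)
  qed
  then show ?thesis by (simp add: A.emeasure_space_1)
qed

text \<open>
  Finiteness of the double integral forces the inner integrals to be finite almost everywhere, and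
  then the diagonal, where for \<open>q < 0\<close> the two kernels differ, is a null set.
\<close>

lemma iterated_riesz_integral:
  fixes \<alpha> \<beta> :: "'a::euclidean_space measure"
  assumes "borel_prob \<alpha>" "borel_prob \<beta>" and fin: "pow_integral q \<alpha> \<beta> < \<infinity>"
  shows "(LINT x|\<alpha>. LINT y|\<beta>. riesz_kernel q (x - y)) = - (1 / q) * enn2real (pow_integral q \<alpha> \<beta>)"
proof -
  note [measurable_cong] = borel_probD(2)[OF assms(1)] borel_probD(2)[OF assms(2)]
  interpret B: sigma_finite_measure \<beta> using borel_probD[OF assms(2)] by simp
  define g where "g x = (\<integral>\<^sup>+y. dist_pow q x y \<partial>\<beta>)" for x
  have gm[measurable]: "g \<in> borel_measurable \<alpha>" unfolding g_def by measurable
  have gi: "(\<integral>\<^sup>+x. g x \<partial>\<alpha>) = pow_integral q \<alpha> \<beta>" by (simp add: g_def pow_integral_def)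
  have gfin: "AE x in \<alpha>. g x \<noteq> \<infinity>"
    using fin gi by (intro nn_integral_PInf_AE) auto
  have inner: "AE x in \<alpha>. (LINT y|\<beta>. norm (x - y) powr q) = enn2real (g x)"
    using gfin
  proof eventually_elim
    fix x assume fx: "g x \<noteq> \<infinity>"
    have "AE y in \<beta>. dist_pow q x y \<noteq> \<infinity>"
      using fx unfolding g_def by (intro nn_integral_PInf_AE) auto
    then have "AE y in \<beta>. dist_pow q x y = ennreal (norm (x - y) powr q)"
      by eventually_elim (auto simp: dist_pow_def dist_norm split: if_splits)
    then show "(LINT y|\<beta>. norm (x - y) powr q) = enn2real (g x)"
      unfolding g_def by (intro enn2real_nn_integral_eq_integral[symmetric]) auto
  qed
  have "(LINT x|\<alpha>. LINT y|\<beta>. riesz_kernel q (x - y)) = - (1 / q) * (LINT x|\<alpha>. LINT y|\<beta>. norm (x - y) powr q)"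
    unfolding riesz_kernel_def by (simp only: integral_mult_right_zero)
  also have "(LINT x|\<alpha>. LINT y|\<beta>. norm (x - y) powr q) = (LINT x|\<alpha>. enn2real (g x))"
    using inner by (intro integral_cong_AE) auto
  also have "\<dots> = enn2real (\<integral>\<^sup>+x. g x \<partial>\<alpha>)"
    using gfin by (intro enn2real_nn_integral_eq_integral[symmetric]) (auto simp: top.not_eq_extremum elim: eventually_mono)
  finally show ?thesis by (simp only: gi)
qed

lemma riesz_energy_eq:
  fixes \<alpha> \<mu> :: "'a::euclidean_space measure"
  assumes "borel_prob \<alpha>" "borel_prob \<mu>" "riesz_energy_finite q \<alpha> \<mu>"
  shows "riesz_energy q \<alpha> \<mu> = 1 / (2 * q) *
    (2 * enn2real (pow_integral q \<alpha> \<mu>) - enn2real (pow_integral q \<alpha> \<alpha>) - enn2real (pow_integral q \<mu> \<mu>))"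
  using assms pow_integral_commute[OF assms(2,1)]
  by (simp add: riesz_energy_def difference_form_def riesz_energy_finite_def iterated_riesz_integral
      algebra_simps add_divide_distrib diff_divide_distrib)

lemma riesz_energy_eq_MMD: "riesz_energy q \<alpha> \<mu> = (1 / q) * MMD_squared q \<alpha> \<mu>"
  unfolding riesz_energy_def MMD_squared_def difference_form_def riesz_kernel_def
  by (simp only: integral_mult_right_zero) (simp add: algebra_simps diff_divide_distrib add_divide_distrib)

section \<open>Dissipation and admissibility\<close>

text \<open>
  The field \<open>G\<close> is measurable only after multiplication by the indicator of \<open>U\<close>; since the integrand
  carries the same indicator, \<open>G\<close> may be replaced by its cut-off version.
\<close>

lemma dissipation_bounded:
  fixes \<rho> :: "'a::euclidean_space \<Rightarrow> real"
  assumes [measurable]: "\<rho> \<in> borel_measurable borel" and one: "(\<integral>\<^sup>+x. \<rho> x \<partial>lborel) = 1"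
    and U[measurable]: "U \<in> sets borel"
    and [measurable]: "source_field q \<rho> \<in> borel_measurable borel" and G: "set_borel_measurable borel U G"
    and "def": "\<And>x. \<rho> x \<noteq> 0 \<Longrightarrow> source_field_defined q \<rho> x"
    and le: "\<And>x. \<rho> x \<noteq> 0 \<Longrightarrow> x \<in> U \<Longrightarrow> norm (source_field q \<rho> x - G x) \<le> D"
  shows "dissipation_finite q U G \<rho>" "0 \<le> dissipation q U G \<rho>" "dissipation q U G \<rho> \<le> D\<^sup>2"
proof -
  interpret P: prob_space "density_measure \<rho>"
    using borel_prob_density_measure[OF assms(1) one] by (simp add: borel_prob_def)
  let ?f = "\<lambda>x. indicator U x *\<^sub>R (norm (source_field q \<rho> x - G x))\<^sup>2"
  have [measurable]: "(\<lambda>x. indicator U x *\<^sub>R G x) \<in> borel_measurable borel"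
    using G by (simp add: set_borel_measurable_def)
  have "?f = (\<lambda>x. indicator U x *\<^sub>R (norm (source_field q \<rho> x - indicator U x *\<^sub>R G x))\<^sup>2)"
    by (auto simp: indicator_def)
  moreover have "\<dots> \<in> borel_measurable (density_measure \<rho>)" by measurable
  ultimately have m: "?f \<in> borel_measurable (density_measure \<rho>)" by simp
  have le': "AE x in density_measure \<rho>. ?f x \<le> D\<^sup>2"
    by (rule AE_density_measure_support[OF assms(1)]) (auto simp: indicator_def intro!: power_mono le)
  have int: "integrable (density_measure \<rho>) ?f"
    using le' m by (intro P.integrable_const_bound[of _ "D\<^sup>2"]) (auto elim: eventually_mono)
  show "dissipation_finite q U G \<rho>"
    unfolding dissipation_finite_def set_integrable_def
    using int AE_density_measure_support[OF assms(1) "def"] by simp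
  show "0 \<le> dissipation q U G \<rho>"
    unfolding dissipation_def set_lebesgue_integral_def by (intro integral_nonneg_AE) auto
  show "dissipation q U G \<rho> \<le> D\<^sup>2"
    unfolding dissipation_def set_lebesgue_integral_def by (rule P.integral_le_const[OF int le'])
qed

lemma smooth_fun_measurable:
  fixes \<rho> :: "'a::euclidean_space \<Rightarrow> real"
  assumes "smooth_fun \<rho>"
  shows "\<rho> \<in> borel_measurable borel"
proof -
  have "Ck_fun 0 \<rho>" using assms unfolding smooth_fun_def by blast
  then show ?thesis by (intro borel_measurable_continuous_onI) simp
qed

lemma smooth_prob_densityI:
  fixes \<rho> :: "'a::euclidean_space \<Rightarrow> real"
  assumes "smooth_fun \<rho>" "\<And>x. 0 \<le> \<rho> x" "\<And>x. \<rho> x \<noteq> 0 \<Longrightarrow> x \<in> ball c r"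
    and "(\<integral>\<^sup>+x. \<rho> x \<partial>lborel) = 1" "cball c r \<subseteq> U"
  shows "smooth_prob_density U \<rho>"
proof -
  have "closure (support_on UNIV \<rho>) \<subseteq> cball c r"
    using assms(3) by (intro closure_minimal) (auto simp: support_on_def less_imp_le)
  moreover from this have "compact (closure (support_on UNIV \<rho>))"
    using bounded_subset[OF bounded_cball] by (auto simp: compact_eq_bounded_closed)
  ultimately show ?thesis
    using assms borel_prob_density_measure[OF smooth_fun_measurable[OF assms(1)] assms(4)]
    by (auto simp: smooth_prob_density_def Cc_infty_def borel_prob_def)
qed

section \<open>Densities spreading out at infinity\<close>

text \<open>
  A constant \<open>C\<close> would give \<open>1 \<le> C * (D / E)\<close> along the sequence, whose right-hand side tends to \<open>0\<close>.
\<close>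

lemma no_uniform_constant:
  assumes adm: "\<And>n. P (\<rho> n)" and pos: "\<And>n. 0 < (E (\<rho> n) :: real)"
    and lim: "(\<lambda>n. D (\<rho> n) / E (\<rho> n)) \<longlonglongrightarrow> 0"
  shows "\<not> (\<exists>C :: real. \<forall>\<rho>. P \<rho> \<longrightarrow> E \<rho> \<le> C * D \<rho>)"
proof
  assume "\<exists>C :: real. \<forall>\<rho>. P \<rho> \<longrightarrow> E \<rho> \<le> C * D \<rho>"
  then obtain C where C: "\<And>\<rho>. P \<rho> \<Longrightarrow> E \<rho> \<le> C * D \<rho>" by blast
  have "1 \<le> C * (D (\<rho> n) / E (\<rho> n))" for n
    using C[OF adm[of n]] pos[of n] by (simp add: le_divide_eq)
  moreover have "(\<lambda>n. C * (D (\<rho> n) / E (\<rho> n))) \<longlonglongrightarrow> C * 0" by (intro tendsto_intros lim)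
  ultimately have "1 \<le> C * 0" by (intro LIMSEQ_le_const[of _ "C * 0"]) auto
  then show False by simp
qed

text \<open>
  The existence of a vanishing sequence and the failure of every constant both follow once the ratio
  \<open>D / E\<close> can be made smaller than any \<open>\<eta> > 0\<close>.
\<close>

lemma vanishing_ratio_sequence:
  fixes E D :: "('a \<Rightarrow> real) \<Rightarrow> real"
  assumes "\<And>\<eta>. 0 < \<eta> \<Longrightarrow> \<exists>\<rho>. P \<rho> \<and> 0 < E \<rho> \<and> 0 \<le> D \<rho> \<and> D \<rho> \<le> \<eta> * E \<rho>"
  shows "(\<exists>\<rho> :: nat \<Rightarrow> 'a \<Rightarrow> real. (\<forall>n. P (\<rho> n) \<and> 0 < E (\<rho> n)) \<and> (\<lambda>n. D (\<rho> n) / E (\<rho> n)) \<longlonglongrightarrow> 0) \<and>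
         \<not> (\<exists>C :: real. \<forall>\<rho>. P \<rho> \<longrightarrow> E \<rho> \<le> C * D \<rho>)"
proof -
  have "\<forall>n. \<exists>\<rho>. P \<rho> \<and> 0 < E \<rho> \<and> 0 \<le> D \<rho> \<and> D \<rho> \<le> 1 / real (Suc n) * E \<rho>"
    by (intro allI assms) simp
  then obtain \<rho> where \<rho>: "\<And>n. P (\<rho> n)" "\<And>n. 0 < E (\<rho> n)" "\<And>n. 0 \<le> D (\<rho> n)"
      "\<And>n. D (\<rho> n) \<le> 1 / real (Suc n) * E (\<rho> n)"
    by metis
  have "(\<lambda>n. D (\<rho> n) / E (\<rho> n)) \<longlonglongrightarrow> 0"
  proof (rule tendsto_sandwich[OF _ _ tendsto_const LIMSEQ_inverse_real_of_nat])
    show "\<forall>\<^sub>F n in sequentially. 0 \<le> D (\<rho> n) / E (\<rho> n)"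
      using \<rho>(2,3) by (auto intro!: always_eventually divide_nonneg_pos)
    show "\<forall>\<^sub>F n in sequentially. D (\<rho> n) / E (\<rho> n) \<le> inverse (real (Suc n))"
      using \<rho>(2,4) by (intro always_eventually allI) (simp add: pos_divide_le_eq inverse_eq_divide)
  qed
  with \<rho>(1,2) show ?thesis using no_uniform_constant[of P \<rho> E D] by blast
qed

lemma norm_in_shifted_ball:
  assumes "e \<in> Basis" "0 \<le> r" "x \<in> ball ((4 * r) *\<^sub>R e) r"
  shows "3 * r \<le> norm x" "norm x \<le> 5 * r"
proof -
  have n: "norm ((4 * r) *\<^sub>R e) = 4 * r" using assms by simp
  have "norm (x - (4 * r) *\<^sub>R e) < r" using assms(3) by (simp add: dist_norm norm_minus_commute)
  then show "3 * r \<le> norm x" "norm x \<le> 5 * r"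
    using norm_triangle_ineq2[of "(4 * r) *\<^sub>R e" x] norm_triangle_ineq2[of x "(4 * r) *\<^sub>R e"] n
    by (simp_all add: norm_minus_commute)
qed

text \<open>
  The support of a spread density is the closure of a subset of the open ball, so the closed ball has
  to lie in the exterior region.
\<close>

lemma cball_shifted_subset:
  assumes "e \<in> Basis" "0 \<le> r" "R0 < 3 * r"
  shows "cball ((4 * r) *\<^sub>R e) r \<subseteq> - cball 0 R0"
proof
  fix x assume "x \<in> cball ((4 * r) *\<^sub>R e) r"
  then have "norm ((4 * r) *\<^sub>R e - x) \<le> r" by (simp add: dist_norm)
  moreover have "norm ((4 * r) *\<^sub>R e) = 4 * r" using assms by simp
  ultimately show "x \<in> - cball 0 R0"
    using norm_triangle_ineq2[of "(4 * r) *\<^sub>R e" x] assms(3) by simp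
qed

text \<open>
  With \<open>s = max 0 (q - 1)\<close> the dissipation is at most \<open>C^2 * r powr (2 * s)\<close>, and the energy is at
  least \<open>((2 * r) powr q - (2 * M) powr q) / (2 * q)\<close> once \<open>\<mu>\<close> lives in the ball of radius \<open>M \<le> r\<close>.
\<close>

lemma small_ratio_positive_exponent:
  fixes \<mu> :: "'a::euclidean_space measure"
  assumes q: "0 < q" "q < 2" and mu: "borel_prob \<mu>" "compact (measure_support \<mu>)" and eta: "0 < \<eta>"
  shows "\<exists>\<rho>. admissible_global q \<mu> \<rho> \<and> 0 < riesz_energy q (density_measure \<rho>) \<mu> \<and>
     0 \<le> dissipation q UNIV (target_field q \<mu>) \<rho> \<and>
     dissipation q UNIV (target_field q \<mu>) \<rho> \<le> \<eta> * riesz_energy q (density_measure \<rho>) \<mu>"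
proof -
  obtain M where M: "1 \<le> M" "\<And>y. y \<in> measure_support \<mu> \<Longrightarrow> norm y \<le> M"
    using compact_imp_bounded[OF mu(2)] unfolding bounded_pos
    by (metis (no_types, opaque_lifting) linear order_trans)
  note mup = borel_probD[OF mu(1)]
  note [measurable_cong] = mup(2)
  interpret mu: prob_space \<mu> by (rule mup(1))
  have muM: "AE y in \<mu>. norm y \<le> M"
    using AE_in_measure_support[OF mup(2)] M(2) by (auto elim: eventually_mono)
  obtain B where B: "0 < B" and
    spread: "\<And>r (c::'a). 1 \<le> r \<Longrightarrow> \<exists>\<rho>. spread_density B c r \<rho>"
    using spread_density_exists[where 'a = 'a] by blast
  have dim: "1 \<le> real DIM('a)" using DIM_positive[where 'a = 'a] by linarith
  define s where "s = max 0 (q - 1)"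
  have s: "0 \<le> s" "q - 1 \<le> s" "2 * s < q" using q by (auto simp: s_def max_def)
  define J where "J = enn2real (ball_moment TYPE('a) (q - 1) 1)"
  have J: "ball_moment TYPE('a) (q - 1) 1 = ennreal J" "0 \<le> J"
    using ball_moment_1_finite[of "q - 1", where 'a = 'a] q dim by (auto simp: J_def)
  \<comment> \<open>The near part of the field of \<open>\<rho>\<close> contributes \<open>B * J\<close>; its far part and the field of \<open>\<mu>\<close>
    contribute \<open>(6 * r) powr s\<close> each, as all distances that occur are at most \<open>6 * r\<close>.\<close>
  define C where "C = B * J + 2 * 6 powr s"
  have C: "0 \<le> C" using B J by (simp add: C_def)
  define k where "k = \<eta> / (2 * q)"
  have k: "0 < k" using eta q by (simp add: k_def)
  have "((\<lambda>r. C\<^sup>2 * r powr (2 * s - q) + k * (2 * M) powr q * r powr (- q)) \<longlongrightarrow>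
          C\<^sup>2 * 0 + k * (2 * M) powr q * 0) at_top"
    using s q by (intro tendsto_intros tendsto_neg_powr filterlim_ident) auto
  then have "\<forall>\<^sub>F r in at_top. C\<^sup>2 * r powr (2 * s - q) + k * (2 * M) powr q * r powr (- q) < k * 2 powr q"
    by (rule order_tendstoD(2)) (use k in simp)
  then have "\<forall>\<^sub>F r in at_top. M \<le> r \<and>
      C\<^sup>2 * r powr (2 * s - q) + k * (2 * M) powr q * r powr (- q) < k * 2 powr q"
    by (rule eventually_conj[OF eventually_ge_at_top])
  then obtain r where r: "M \<le> r"
    and small: "C\<^sup>2 * r powr (2 * s - q) + k * (2 * M) powr q * r powr (- q) < k * 2 powr q"
    using eventually_happens' trivial_limit_at_top_linorder by blast
  have r1: "1 \<le> r" using M r by linarith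
  \<comment> \<open>The comparison of dissipation and energy, after multiplication by \<open>r powr q\<close>.\<close>
  have rq: "C\<^sup>2 * r powr (2 * s) + k * (2 * M) powr q < k * (2 * r) powr q"
  proof -
    have "(C\<^sup>2 * r powr (2 * s - q) + k * (2 * M) powr q * r powr (- q)) * r powr q < k * 2 powr q * r powr q"
      using small r1 by (intro mult_strict_right_mono) auto
    moreover have "r powr (2 * s - q) * r powr q = r powr (2 * s)" "r powr (- q) * r powr q = 1"
      using r1 by (simp_all only: flip: powr_add) auto
    ultimately show ?thesis
      using r1 by (simp add: distrib_right powr_mult mult.assoc)
  qed
  obtain e :: 'a where e: "e \<in> Basis" using nonempty_Basis by blast
  let ?c = "(4 * r) *\<^sub>R e"
  obtain \<rho> where smooth: "smooth_fun \<rho>" and nn: "\<And>x. 0 \<le> \<rho> x" and sup: "\<And>x. \<rho> x \<noteq> 0 \<Longrightarrow> x \<in> ball ?c r"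
    and le: "\<And>x. \<rho> x \<le> B / r ^ DIM('a)" and one: "(\<integral>\<^sup>+x. \<rho> x \<partial>lborel) = 1"
    using spread[OF r1, of ?c] unfolding spread_density_def by blast
  have leB: "\<rho> x \<le> B" for x
  proof -
    have "B / r ^ DIM('a) \<le> B / 1"
      using B one_le_power[OF r1, of "DIM('a)"] by (intro divide_left_mono) auto
    then show ?thesis using le[of x] by simp
  qed
  have meas[measurable]: "\<rho> \<in> borel_measurable borel" by (rule smooth_fun_measurable[OF smooth])
  let ?\<alpha> = "density_measure \<rho>"
  have alpha: "borel_prob ?\<alpha>" by (rule borel_prob_density_measure[OF meas one])
  note alp = borel_probD[OF alpha]
  have far: "2 * r \<le> norm (x - y)" "norm (x - y) \<le> 6 * r" if "\<rho> x \<noteq> 0" "norm y \<le> M" for x y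
    using norm_in_shifted_ball[OF e _ sup[OF that(1)]] that(2) r r1
      norm_triangle_ineq2[of x y] norm_triangle_ineq4[of x y] by auto
  have near: "norm (x - y) \<le> 2 * r" if "\<rho> x \<noteq> 0" "\<rho> y \<noteq> 0" for x y
    using sup[OF that(1)] sup[OF that(2)] dist_triangle2[of x y ?c]
    by (simp add: dist_norm norm_minus_commute)
  have dp: "dist_pow q x y = ennreal (norm (x - y) powr q)" for x y :: 'a
    using q by (simp add: dist_pow_def dist_norm)
  have am_ge: "ennreal ((2 * r) powr q) \<le> pow_integral q ?\<alpha> \<mu>"
  proof (rule pow_integral_geI[OF alp(1) mup(1)], rule AE_density_measure_support[OF meas])
    fix x assume x: "\<rho> x \<noteq> 0"
    show "AE y in \<mu>. ennreal ((2 * r) powr q) \<le> dist_pow q x y"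
      using muM by eventually_elim (use far(1)[OF x] q r1 in \<open>auto simp: dp intro!: ennreal_leI powr_mono2\<close>)
  qed
  have am_le: "pow_integral q ?\<alpha> \<mu> \<le> ennreal ((6 * r) powr q)"
  proof (rule pow_integral_leI[OF alp(1) mup(1)], rule AE_density_measure_support[OF meas])
    fix x assume x: "\<rho> x \<noteq> 0"
    show "AE y in \<mu>. dist_pow q x y \<le> ennreal ((6 * r) powr q)"
      using muM by eventually_elim (use far(2)[OF x] q r1 in \<open>auto simp: dp intro!: ennreal_leI powr_mono2\<close>)
  qed
  have aa_le: "pow_integral q ?\<alpha> ?\<alpha> \<le> ennreal ((2 * r) powr q)"
    using near q
    by (intro pow_integral_leI[OF alp(1) alp(1)] AE_density_measure_support[OF meas])
      (auto simp: dp intro!: ennreal_leI powr_mono2)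
  have mm_le: "pow_integral q \<mu> \<mu> \<le> ennreal ((2 * M) powr q)"
  proof (rule pow_integral_leI[OF mup(1) mup(1)])
    show "AE x in \<mu>. AE y in \<mu>. dist_pow q x y \<le> ennreal ((2 * M) powr q)"
      using muM
    proof eventually_elim
      fix x :: 'a assume x: "norm x \<le> M"
      show "AE y in \<mu>. dist_pow q x y \<le> ennreal ((2 * M) powr q)"
        using muM
      proof eventually_elim
        fix y :: 'a assume y: "norm y \<le> M"
        have "norm (x - y) \<le> 2 * M" using x y norm_triangle_ineq4[of x y] by linarith
        then show "dist_pow q x y \<le> ennreal ((2 * M) powr q)"
          using q by (auto simp: dp intro!: ennreal_leI powr_mono2)
      qed
    qed
  qed
  have efin: "riesz_energy_finite q ?\<alpha> \<mu>"
    unfolding riesz_energy_finite_def pow_integral_commute[OF mu(1) alpha]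
    using am_le aa_le mm_le by (auto intro: le_less_trans)
  have "enn2real (pow_integral q ?\<alpha> \<mu>) \<ge> (2 * r) powr q"
    using enn2real_mono[OF am_ge] am_le by (simp add: le_less_trans)
  moreover have "enn2real (pow_integral q ?\<alpha> ?\<alpha>) \<le> (2 * r) powr q"
    using enn2real_mono[OF aa_le] by simp
  moreover have "enn2real (pow_integral q \<mu> \<mu>) \<le> (2 * M) powr q"
    using enn2real_mono[OF mm_le] by simp
  ultimately have elow0: "1 / (2 * q) * ((2 * r) powr q - (2 * M) powr q) \<le> riesz_energy q ?\<alpha> \<mu>"
    unfolding riesz_energy_eq[OF alpha mu(1) efin] using q by (intro mult_left_mono) auto
  have elow: "k * ((2 * r) powr q - (2 * M) powr q) \<le> \<eta> * riesz_energy q ?\<alpha> \<mu>"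
    using mult_left_mono[OF elow0 less_imp_le[OF eta]] by (simp add: k_def)
  have Cr: "C\<^sup>2 * r powr (2 * s) = (C * r powr s)\<^sup>2"
    using powr_add[of r s s] by (simp add: power2_eq_square)
  have "0 \<le> (C * r powr s)\<^sup>2" by simp
  then have "0 < \<eta> * riesz_energy q ?\<alpha> \<mu>"
    using elow rq unfolding Cr by (simp only: right_diff_distrib)
  then have epos: "0 < riesz_energy q ?\<alpha> \<mu>" using eta by (simp add: zero_less_mult_iff)
  have tint: "integrable \<mu> (\<lambda>y. grad_riesz_kernel q (x - y)) \<and> norm (target_field q \<mu> x) \<le> (6 * r) powr s"
    if x: "\<rho> x \<noteq> 0" for x
  proof -
    have ae: "AE y in \<mu>. norm (grad_riesz_kernel q (x - y)) \<le> (6 * r) powr s"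
      using muM
    proof eventually_elim
      fix y :: 'a assume y: "norm y \<le> M"
      have "norm (x - y) powr (q - 1) \<le> norm (x - y) powr s"
        using far(1)[OF x y] r1 s by (intro powr_mono) auto
      also have "\<dots> \<le> (6 * r) powr s" using far(2)[OF x y] s by (intro powr_mono2) auto
      finally show "norm (grad_riesz_kernel q (x - y)) \<le> (6 * r) powr s"
        by (simp add: norm_grad_riesz_kernel)
    qed
    have int: "integrable \<mu> (\<lambda>y. grad_riesz_kernel q (x - y))"
      using ae by (intro mu.integrable_const_bound[of _ "(6 * r) powr s"]) auto
    have "norm (target_field q \<mu> x) \<le> (LINT y|\<mu>. norm (grad_riesz_kernel q (x - y)))"
      unfolding target_field_def by (rule integral_norm_bound)
    also have "\<dots> \<le> (6 * r) powr s" using int ae by (intro mu.integral_le_const) auto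
    finally show ?thesis using int by simp
  qed
  have sq: "1 - real DIM('a) < q" using q dim by linarith
  have src: "source_field_defined q \<rho> x \<and> norm (source_field q \<rho> x) \<le> B * J + (6 * r) powr s"
    if x: "\<rho> x \<noteq> 0" for x
  proof -
    have "(\<integral>\<^sup>+y. ennreal (\<rho> y) * ennreal (norm (x - y) powr (q - 1)) \<partial>lborel)
        \<le> ennreal B * ball_moment TYPE('a) (q - 1) 1 + ennreal ((6 * r) powr s)"
    proof (rule potential_of_bounded_density_le[OF meas nn leB])
      fix y assume y: "\<rho> y \<noteq> 0" "1 < norm (x - y)"
      have "norm (x - y) powr (q - 1) \<le> norm (x - y) powr s"
        using y s by (intro powr_mono) auto
      also have "\<dots> \<le> (6 * r) powr s" using near[OF x y(1)] r1 s by (intro powr_mono2) auto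
      finally show "norm (x - y) powr (q - 1) \<le> (6 * r) powr s" .
    qed (use one in auto)
    also have "\<dots> = ennreal (B * J + (6 * r) powr s)"
      using B J by (simp add: ennreal_mult)
    finally have "(\<integral>\<^sup>+y. ennreal (\<rho> y) * ennreal (norm (x - y) powr (q - 1)) \<partial>lborel)
        \<le> ennreal (B * J + (6 * r) powr s)" .
    from convolution_field_bound[OF meas nn this] show ?thesis
      using sq B J by (simp add: source_field_def source_field_defined_def)
  qed
  have sm: "source_field q \<rho> \<in> borel_measurable borel"
    unfolding source_field_def[abs_def] using sq by simp
  have tm: "set_borel_measurable borel UNIV (target_field q \<mu>)"
    unfolding set_borel_measurable_def target_field_def by simp
  have diff: "norm (source_field q \<rho> x - target_field q \<mu> x) \<le> C * r powr s" if x: "\<rho> x \<noteq> 0" for x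
  proof -
    have "norm (source_field q \<rho> x - target_field q \<mu> x) \<le> B * J + 2 * (6 * r) powr s"
      using src[OF x] tint[OF x] norm_triangle_ineq4[of "source_field q \<rho> x" "target_field q \<mu> x"] by linarith
    also have "\<dots> = B * J * 1 + 2 * 6 powr s * r powr s" using r1 by (simp add: powr_mult)
    also have "\<dots> \<le> B * J * r powr s + 2 * 6 powr s * r powr s"
      using B J s r1 by (intro add_right_mono mult_left_mono ge_one_powr_ge_zero) auto
    also have "\<dots> = C * r powr s" by (simp add: C_def distrib_right)
    finally show ?thesis .
  qed
  have U: "UNIV \<in> sets (borel :: 'a measure)" by simp
  have dis: "dissipation_finite q UNIV (target_field q \<mu>) \<rho>" "0 \<le> dissipation q UNIV (target_field q \<mu>) \<rho>"
      "dissipation q UNIV (target_field q \<mu>) \<rho> \<le> (C * r powr s)\<^sup>2"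
    by (rule dissipation_bounded[OF meas one U sm tm, where D = "C * r powr s"]; use src diff in blast)+
  note dis(3)
  also have "\<dots> \<le> \<eta> * riesz_energy q ?\<alpha> \<mu>"
    using elow rq unfolding Cr by (simp only: right_diff_distrib)
  finally have "dissipation q UNIV (target_field q \<mu>) \<rho> \<le> \<eta> * riesz_energy q ?\<alpha> \<mu>" .
  moreover have "admissible_global q \<mu> \<rho>"
    unfolding admissible_global_def
    using smooth_prob_densityI[OF smooth nn sup one, of UNIV] efin dis(1) tint
    by (auto intro!: AE_density_measure_support[OF meas])
  ultimately show ?thesis using epos dis(2) by blast
qed

text \<open>
  All interactions of \<open>\<rho>\<close> become negligible, so the energy stays above half of that of \<open>\<mu>\<close> while both
  fields fall below \<open>\<delta> / 2\<close>; here \<open>\<delta>\<close> is chosen so that \<open>\<delta>^2\<close> is \<open>\<eta>\<close> times this lower bound.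
\<close>

lemma small_ratio_negative_exponent:
  fixes \<mu> :: "'a::euclidean_space measure"
  assumes q: "- real DIM('a) < q" "q < 0" and mu: "borel_prob \<mu>"
    and en: "0 < pow_integral q \<mu> \<mu>" "pow_integral q \<mu> \<mu> < \<infinity>"
    and Fm: "set_borel_measurable borel (- cball 0 R0) F" and F0: "((\<lambda>x. norm (F x)) \<longlongrightarrow> 0) at_infinity"
    and eta: "0 < \<eta>"
  shows "\<exists>\<rho>. admissible_exterior q \<mu> R0 F \<rho> \<and> 0 < riesz_energy q (density_measure \<rho>) \<mu> \<and>
     0 \<le> dissipation q (- cball 0 R0) F \<rho> \<and>
     dissipation q (- cball 0 R0) F \<rho> \<le> \<eta> * riesz_energy q (density_measure \<rho>) \<mu>"
proof -
  note mup = borel_probD[OF mu]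
  obtain B where B: "0 < B" and
    spread: "\<And>r (c::'a). 1 \<le> r \<Longrightarrow> \<exists>\<rho>. spread_density B c r \<rho>"
    using spread_density_exists[where 'a = 'a] by blast
  define p where "p = enn2real (pow_integral q \<mu> \<mu>)"
  have p: "0 < p" using en by (simp add: p_def enn2real_positive_iff)
  define k where "k = - 1 / (2 * q)"
  have k: "0 < k" using q by (simp add: k_def divide_less_0_iff)
  define \<delta> where "\<delta> = sqrt (\<eta> * (k * (p / 2)))"
  have \<delta>: "0 < \<delta>" "\<delta>\<^sup>2 = \<eta> * (k * (p / 2))" using eta k p by (simp_all add: \<delta>_def)
  define a where "a = (if 1 - real DIM('a) < q then q - 1 else q)"
  have a: "- real DIM('a) < a" "a < 0" using q by (auto simp: a_def)
  define S where "S b r = spread_bound TYPE('a) b (B / r ^ DIM('a)) (sqrt r)" for b r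
  have "\<forall>\<^sub>F x in at_infinity. norm (F x) < \<delta> / 2"
    using order_tendstoD(2)[OF F0, of "\<delta> / 2"] \<delta> by simp
  then obtain b where b: "\<And>x. b \<le> norm x \<Longrightarrow> norm (F x) < \<delta> / 2"
    unfolding eventually_at_infinity by blast
  have "\<forall>\<^sub>F r in at_top. S q r < p / 4" "\<forall>\<^sub>F r in at_top. S a r < \<delta> / 2"
    unfolding S_def
    using order_tendstoD(2)[OF spread_bound_tendsto_0[OF q, of B], of "p / 4"]
      order_tendstoD(2)[OF spread_bound_tendsto_0[OF a, of B], of "\<delta> / 2"] p \<delta> by auto
  then have "\<forall>\<^sub>F r in at_top. S q r < p / 4 \<and> S a r < \<delta> / 2 \<and> max 1 (max \<bar>b\<bar> \<bar>R0\<bar>) \<le> r"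
    by (intro eventually_conj eventually_ge_at_top)
  then obtain r where r: "S q r < p / 4" "S a r < \<delta> / 2" "max 1 (max \<bar>b\<bar> \<bar>R0\<bar>) \<le> r"
    using eventually_happens' trivial_limit_at_top_linorder by blast
  have r1: "1 \<le> r" "b \<le> 3 * r" "R0 < 3 * r" using r(3) by auto
  have sr: "1 \<le> sqrt r" using r1 by simp
  obtain e :: 'a where e: "e \<in> Basis" using nonempty_Basis by blast
  let ?c = "(4 * r) *\<^sub>R e" and ?U = "- cball (0::'a) R0"
  obtain \<rho> where smooth: "smooth_fun \<rho>" and nn: "\<And>x. 0 \<le> \<rho> x" and sup: "\<And>x. \<rho> x \<noteq> 0 \<Longrightarrow> x \<in> ball ?c r"
    and le: "\<And>x. \<rho> x \<le> B / r ^ DIM('a)"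
    and lip: "\<And>x y. \<bar>\<rho> x - \<rho> y\<bar> \<le> B / r ^ DIM('a) * dist x y"
    and one: "(\<integral>\<^sup>+x. \<rho> x \<partial>lborel) = 1"
    using spread[OF r1(1), of ?c] unfolding spread_density_def by blast
  have one': "(\<integral>\<^sup>+x. \<rho> x \<partial>lborel) \<le> 1" using one by simp
  have meas[measurable]: "\<rho> \<in> borel_measurable borel" by (rule smooth_fun_measurable[OF smooth])
  let ?\<alpha> = "density_measure \<rho>"
  have alpha: "borel_prob ?\<alpha>" by (rule borel_prob_density_measure[OF meas one])
  note alp = borel_probD[OF alpha]
  \<comment> \<open>The bound is uniform in \<open>x\<close>, so it controls the mixed energy with any probability measure.\<close>
  have inner: "(\<integral>\<^sup>+y. dist_pow q x y \<partial>?\<alpha>) \<le> ennreal (S q r)" for x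
  proof -
    have "(\<integral>\<^sup>+y. dist_pow q x y \<partial>?\<alpha>) = (\<integral>\<^sup>+y. ennreal (\<rho> y) * dist_pow q x y \<partial>lborel)"
      by (subst nn_integral_density) auto
    also have "\<dots> = (\<integral>\<^sup>+y. ennreal (\<rho> y) * ennreal (norm (x - y) powr q) \<partial>lborel)"
      using AE_lborel_singleton[of x] by (intro nn_integral_cong_AE) (auto simp: dist_pow_def dist_norm elim: eventually_mono)
    also have "\<dots> \<le> ennreal (S q r)"
      unfolding S_def by (rule potential_le_spread_bound[OF meas nn le one' q sr])
    finally show ?thesis .
  qed
  have outer: "pow_integral q \<nu> ?\<alpha> \<le> ennreal (S q r)" if "prob_space \<nu>" for \<nu>
  proof -
    interpret prob_space \<nu> by fact
    have "pow_integral q \<nu> ?\<alpha> \<le> (\<integral>\<^sup>+x. ennreal (S q r) \<partial>\<nu>)"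
      unfolding pow_integral_def by (intro nn_integral_mono inner)
    then show ?thesis by (simp add: emeasure_space_1)
  qed
  have am: "pow_integral q ?\<alpha> \<mu> \<le> ennreal (S q r)"
    using outer[OF mup(1)] pow_integral_commute[OF alpha mu] by simp
  have efin: "riesz_energy_finite q ?\<alpha> \<mu>"
    unfolding riesz_energy_finite_def pow_integral_commute[OF mu alpha]
    using am outer[OF alp(1)] en by (auto intro: le_less_trans)
  have "0 \<le> S q r" unfolding S_def using B r1 by (intro spread_bound_nonneg) auto
  then have "enn2real (pow_integral q ?\<alpha> \<mu>) \<le> p / 4" using enn2real_mono[OF am] r(1) by simp
  then have "k * (p / 2) \<le> k * (p + enn2real (pow_integral q ?\<alpha> ?\<alpha>) - 2 * enn2real (pow_integral q ?\<alpha> \<mu>))"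
    using k enn2real_nonneg[of "pow_integral q ?\<alpha> ?\<alpha>"] by (intro mult_left_mono) linarith+
  also have "\<dots> = riesz_energy q ?\<alpha> \<mu>"
    unfolding riesz_energy_eq[OF alpha mu efin] k_def p_def by (simp add: algebra_simps add_divide_distrib diff_divide_distrib)
  finally have elow: "k * (p / 2) \<le> riesz_energy q ?\<alpha> \<mu>" .
  have "0 < k * (p / 2)" using k p by simp
  then have epos: "0 < riesz_energy q ?\<alpha> \<mu>" using elow by linarith
  note src = source_field_spread[OF meas nn le one' lip q sr, folded a_def, folded S_def]
  have diff: "norm (source_field q \<rho> x - F x) \<le> \<delta>" if "\<rho> x \<noteq> 0" for x
  proof -
    have "b \<le> norm x" using norm_in_shifted_ball(1)[OF e _ sup[OF that]] r1 by linarith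
    then show ?thesis
      using b[of x] src(2)[of x] r(2) norm_triangle_ineq4[of "source_field q \<rho> x" "F x"] by linarith
  qed
  have U: "?U \<in> sets borel" by simp
  have dis: "dissipation_finite q ?U F \<rho>" "0 \<le> dissipation q ?U F \<rho>" "dissipation q ?U F \<rho> \<le> \<delta>\<^sup>2"
    by (rule dissipation_bounded[OF meas one U src(3) Fm src(1), where D = \<delta>]; use diff in blast)+
  have "dissipation q ?U F \<rho> \<le> \<eta> * (k * (p / 2))" using dis(3) \<delta>(2) by simp
  also have "\<dots> \<le> \<eta> * riesz_energy q ?\<alpha> \<mu>" using elow eta by (intro mult_left_mono) auto
  finally have "dissipation q ?U F \<rho> \<le> \<eta> * riesz_energy q ?\<alpha> \<mu>" .
  moreover have "admissible_exterior q \<mu> R0 F \<rho>"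
    unfolding admissible_exterior_def
    using smooth_prob_densityI[OF smooth nn sup one cball_shifted_subset[OF e _ r1(3)]] r1 efin dis(1) by auto
  ultimately show ?thesis using epos dis(2) by blast
qed

theorem proposition6p2:
  fixes \<mu> :: "'a::euclidean_space measure" and q :: real
  assumes "- real DIM('a) < q" and "q < 2" and "q \<noteq> 0"
    and "borel_prob \<mu>"
  shows
    "(0 < q \<longrightarrow> compact (measure_support \<mu>) \<longrightarrow>
        (\<exists>\<rho> :: nat \<Rightarrow> 'a \<Rightarrow> real.
           (\<forall>n. admissible_global q \<mu> (\<rho> n) \<and> 0 < riesz_energy q (density_measure (\<rho> n)) \<mu>) \<and>
           (\<lambda>n. dissipation q UNIV (target_field q \<mu>) (\<rho> n) / riesz_energy q (density_measure (\<rho> n)) \<mu>)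
             \<longlonglongrightarrow> 0) \<and>
        (\<forall>\<rho> :: nat \<Rightarrow> 'a \<Rightarrow> real. (\<forall>n. admissible_global q \<mu> (\<rho> n)) \<longrightarrow>
           ((\<lambda>n. dissipation q UNIV (target_field q \<mu>) (\<rho> n) / riesz_energy q (density_measure (\<rho> n)) \<mu>)
              \<longlonglongrightarrow> 0) =
           ((\<lambda>n. dissipation q UNIV (target_field q \<mu>) (\<rho> n) / MMD_squared q (density_measure (\<rho> n)) \<mu>)
              \<longlonglongrightarrow> 0)) \<and>
        \<not> (\<exists>C :: real. \<forall>\<rho>. admissible_global q \<mu> \<rho> \<longrightarrow>
              riesz_energy q (density_measure \<rho>) \<mu> \<le> C * dissipation q UNIV (target_field q \<mu>) \<rho>))
     \<and>
     (q < 0 \<longrightarrow> 0 < pow_integral q \<mu> \<mu> \<longrightarrow> pow_integral q \<mu> \<mu> < \<infinity> \<longrightarrow>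
       (\<forall>(R0 :: real) (F :: 'a \<Rightarrow> 'a).
          set_borel_measurable borel (- cball 0 R0) F \<longrightarrow>
          locally_integrable_in (- cball 0 R0) F \<longrightarrow>
          (\<forall>x \<in> - cball 0 R0. potential_finite q \<mu> x) \<longrightarrow>
          distributional_gradient_in (- cball 0 R0) (potential q \<mu>) F \<longrightarrow>
          ((\<lambda>x. \<bar>potential q \<mu> x\<bar> + norm (F x)) \<longlongrightarrow> 0) at_infinity \<longrightarrow>
          (\<exists>\<rho> :: nat \<Rightarrow> 'a \<Rightarrow> real.
             (\<forall>n. admissible_exterior q \<mu> R0 F (\<rho> n) \<and>
                  0 < riesz_energy q (density_measure (\<rho> n)) \<mu>) \<and>
             (\<lambda>n. dissipation q (- cball 0 R0) F (\<rho> n) / riesz_energy q (density_measure (\<rho> n)) \<mu>)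
               \<longlonglongrightarrow> 0) \<and>
          \<not> (\<exists>C :: real. \<forall>\<rho>. admissible_exterior q \<mu> R0 F \<rho> \<longrightarrow>
                riesz_energy q (density_measure \<rho>) \<mu> \<le> C * dissipation q (- cball 0 R0) F \<rho>)))"
proof (intro conjI impI allI)
  assume q: "0 < q" and supp: "compact (measure_support \<mu>)"
  note main = vanishing_ratio_sequence[OF small_ratio_positive_exponent[OF q assms(2,4) supp]]
  show "\<exists>\<rho> :: nat \<Rightarrow> 'a \<Rightarrow> real.
           (\<forall>n. admissible_global q \<mu> (\<rho> n) \<and> 0 < riesz_energy q (density_measure (\<rho> n)) \<mu>) \<and>
           (\<lambda>n. dissipation q UNIV (target_field q \<mu>) (\<rho> n) / riesz_energy q (density_measure (\<rho> n)) \<mu>)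
             \<longlonglongrightarrow> 0"
    using main by (rule conjunct1)
  show "\<not> (\<exists>C :: real. \<forall>\<rho>. admissible_global q \<mu> \<rho> \<longrightarrow>
              riesz_energy q (density_measure \<rho>) \<mu> \<le> C * dissipation q UNIV (target_field q \<mu>) \<rho>)"
    using main by (rule conjunct2)
  fix \<rho> :: "nat \<Rightarrow> 'a \<Rightarrow> real"
  let ?D = "\<lambda>n. dissipation q UNIV (target_field q \<mu>) (\<rho> n)"
  have "?D n / riesz_energy q (density_measure (\<rho> n)) \<mu> = q * (?D n / MMD_squared q (density_measure (\<rho> n)) \<mu>)" for n
    by (simp add: riesz_energy_eq_MMD)
  then show "((\<lambda>n. ?D n / riesz_energy q (density_measure (\<rho> n)) \<mu>) \<longlonglongrightarrow> 0) =
             ((\<lambda>n. ?D n / MMD_squared q (density_measure (\<rho> n)) \<mu>) \<longlonglongrightarrow> 0)"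
    using q tendsto_mult_left_iff[of q "\<lambda>n. ?D n / MMD_squared q (density_measure (\<rho> n)) \<mu>" 0] by simp
next
  fix R0 :: real and F :: "'a \<Rightarrow> 'a"
  assume q: "q < 0" and en: "0 < pow_integral q \<mu> \<mu>" "pow_integral q \<mu> \<mu> < \<infinity>"
    and Fm: "set_borel_measurable borel (- cball 0 R0) F"
    and lim: "((\<lambda>x. \<bar>potential q \<mu> x\<bar> + norm (F x)) \<longlongrightarrow> 0) at_infinity"
  have F0: "((\<lambda>x. norm (F x)) \<longlongrightarrow> 0) at_infinity"
    by (rule tendsto_sandwich[OF _ _ tendsto_const lim]) auto
  note main = vanishing_ratio_sequence[OF small_ratio_negative_exponent[OF assms(1) q assms(4) en Fm F0]]
  show "\<exists>\<rho> :: nat \<Rightarrow> 'a \<Rightarrow> real.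
             (\<forall>n. admissible_exterior q \<mu> R0 F (\<rho> n) \<and>
                  0 < riesz_energy q (density_measure (\<rho> n)) \<mu>) \<and>
             (\<lambda>n. dissipation q (- cball 0 R0) F (\<rho> n) / riesz_energy q (density_measure (\<rho> n)) \<mu>)
               \<longlonglongrightarrow> 0"
    using main by (rule conjunct1)
  show "\<not> (\<exists>C :: real. \<forall>\<rho>. admissible_exterior q \<mu> R0 F \<rho> \<longrightarrow>
                riesz_energy q (density_measure \<rho>) \<mu> \<le> C * dissipation q (- cball 0 R0) F \<rho>)"
    using main by (rule conjunct2)
qed

end
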